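(* Let $r\ge 2$ be an integer and let $H$ be a bipartite graph such that in one of the parts of its bipartition all the degrees are at most $r$ and $H$ does not contain $C_4$ (the cycle of length 4) as a subgraph. Then $\mathrm{ex}(n,H)=o(n^{2-1/r})$ as $n\to\infty$.
   Context: For a graph $H$, the extremal number $\mathrm{ex}(n,H)$ is the maximum number of edges in an $n$-vertex (simple) graph which does not contain $H$ as a (not necessarily induced) subgraph. $H$ is a fixed finite graph. *)

theory Defs
  imports Complex_Main "HOL-Library.Landau_Symbols"
begin

record 'a ugraph =
  verts :: "'a set"
  edges :: "'a set set"

definition simple_graph :: "'a ugraph \<Rightarrow> bool" where
  "simple_graph G \<longleftrightarrow>
     finite (verts G) \<and> (\<forall>e\<in>edges G. e \<subseteq> verts G \<and> card e = 2)"

definition degree :: "'a ugraph \<Rightarrow> 'a \<Rightarrow> nat" where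
  "degree G v = card {e \<in> edges G. v \<in> e}"

definition bipartition :: "'a ugraph \<Rightarrow> 'a set \<Rightarrow> 'a set \<Rightarrow> bool" where
  "bipartition G A B \<longleftrightarrow>
     A \<union> B = verts G \<and> A \<inter> B = {} \<and>
     (\<forall>e\<in>edges G. \<exists>a\<in>A. \<exists>b\<in>B. e = {a, b})"

definition subgraph :: "'a ugraph \<Rightarrow> 'a ugraph \<Rightarrow> bool" where
  "subgraph K G \<longleftrightarrow> simple_graph K \<and> verts K \<subseteq> verts G \<and> edges K \<subseteq> edges G"

definition isomorphic :: "'a ugraph \<Rightarrow> 'b ugraph \<Rightarrow> bool" where
  "isomorphic H K \<longleftrightarrow>
     (\<exists>f. bij_betw f (verts H) (verts K) \<and> (\<lambda>e. f ` e) ` edges H = edges K)"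

definition contains_graph :: "'b ugraph \<Rightarrow> 'a ugraph \<Rightarrow> bool" where
  "contains_graph G H \<longleftrightarrow> (\<exists>K. subgraph K G \<and> isomorphic H K)"

text \<open>The cycle of length \<open>k\<close>, meaningful for \<open>k \<ge> 3\<close>.\<close>

definition cycle_graph :: "nat \<Rightarrow> nat ugraph" where
  "cycle_graph k = \<lparr>verts = {..<k}, edges = {{i, Suc i mod k} | i. i < k}\<rparr>"

text \<open>
  Every finite graph has an isomorphic copy on natural numbers, so host graphs are
  taken with vertices of type \<^typ>\<open>nat\<close>. The set below is finite
  (\<open>finite_edge_counts\<close>), so its supremum is a maximum whenever it is nonempty. It is
  empty exactly when every graph on \<open>n\<close> vertices contains \<open>H\<close>, which for large \<open>n\<close>
  happens only for edgeless \<open>H\<close>; there \<^term>\<open>Sup {} = (0::nat)\<close> gives the value 0.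
\<close>

definition extremal_number :: "nat \<Rightarrow> 'a ugraph \<Rightarrow> nat" where
  "extremal_number n H =
     Sup {card (edges G) | G :: nat ugraph.
            simple_graph G \<and> card (verts G) = n \<and> \<not> contains_graph G H}"

lemma contains_graph_iff_embedding:
  fixes G :: "'b ugraph" and H :: "'a ugraph"
  assumes "simple_graph G" "simple_graph H"
  shows "contains_graph G H \<longleftrightarrow>
           (\<exists>f. inj_on f (verts H) \<and> f ` verts H \<subseteq> verts G \<and> (\<forall>e\<in>edges H. f ` e \<in> edges G))"
    (is "_ \<longleftrightarrow> ?R")
proof
  assume "contains_graph G H"
  then obtain K :: "'b ugraph" and f :: "'a \<Rightarrow> 'b" where K: "verts K \<subseteq> verts G" "edges K \<subseteq> edges G"
    and f: "inj_on f (verts H)" "f ` verts H = verts K" "(\<lambda>e. f ` e) ` edges H = edges K"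
    by (auto simp: contains_graph_def subgraph_def isomorphic_def bij_betw_def)
  have "f ` e \<in> edges G" if "e \<in> edges H" for e
    using imageI[OF that, of "\<lambda>e. f ` e"] f(3) K(2) by auto
  then show ?R using f(1,2) K(1) by (intro exI[of _ f]) simp
next
  assume ?R
  then obtain f where f: "inj_on f (verts H)" "f ` verts H \<subseteq> verts G"
    "\<forall>e\<in>edges H. f ` e \<in> edges G" by blast
  let ?K = "\<lparr>verts = f ` verts H, edges = (\<lambda>e. f ` e) ` edges H\<rparr>"
  have "card (f ` e) = 2 \<and> f ` e \<subseteq> f ` verts H" if "e \<in> edges H" for e
  proof -
    have "e \<subseteq> verts H" "card e = 2"
      using assms(2) that by (auto simp: simple_graph_def)
    then show ?thesis
      using card_image[OF inj_on_subset[OF f(1)], of e] by (simp add: image_mono)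
  qed
  then have "subgraph ?K G"
    using f(2,3) assms(2) by (simp add: subgraph_def simple_graph_def image_subset_iff)
  moreover have "isomorphic H ?K"
    unfolding isomorphic_def using f(1) by (auto simp: bij_betw_def)
  ultimately show "contains_graph G H" unfolding contains_graph_def by blast
qed

lemma finite_edge_counts:
  "finite {card (edges G) | G :: nat ugraph.
             simple_graph G \<and> card (verts G) = n \<and> \<not> contains_graph G H}"
proof (rule finite_subset)
  have "card (edges G) \<le> 2 ^ n" if "simple_graph G" "card (verts G) = n" for G :: "nat ugraph"
  proof -
    have "edges G \<subseteq> Pow (verts G)" "finite (verts G)"
      using that(1) unfolding simple_graph_def by auto
    then show ?thesis
      using card_mono[of "Pow (verts G)" "edges G"] that(2) by (simp add: card_Pow)
  qed
  then show "{card (edges G) | G :: nat ugraph.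
      simple_graph G \<and> card (verts G) = n \<and> \<not> contains_graph G H} \<subseteq> {..2 ^ n}"
    by auto
qed simp

end

theory Submission
  imports "HOL-Analysis.Convex" "HOL-Library.Ramsey" Defs
begin

text \<open>
  A \<open>C\<^sub>4\<close>-free bipartite \<open>H\<close> whose degrees in \<open>B\<close> are at most \<open>r\<close> is contained in the incidence
  graph of a linear \<open>r\<close>-uniform hypergraph on \<open>A\<close> and some dummy vertices: the hyperedges are the
  neighbourhoods of the vertices in \<open>B\<close>, and two of them meet in at most one vertex.

  Let \<open>G\<close> have \<open>n\<close> vertices and more than \<open>c n\<^bsup>2-1/r\<^esup>\<close> edges, and cut each neighbourhood into
  disjoint pieces of size \<open>s\<close>, of order \<open>n\<^bsup>1-1/r\<^esup>\<close>; this gives at least \<open>n\<close> pieces. The pieces contain about \<open>n s\<^sup>r\<close>, that is \<open>n\<^sup>r\<close>, many \<open>r\<close>-sets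
  counted with multiplicity. Call an \<open>r\<close>-set inside a piece light if it lies in boundedly many pieces,
  and heavy otherwise. If some large set has only heavy \<open>r\<close>-subsets, then \<open>H\<close> embeds greedily.
  Otherwise, by Ramsey's theorem, every large subset of a piece contains a clique of light sets, and such
  cliques survive the removal of a small proportion of the light sets. By a removal lemma for linear
  hypergraphs (regularity and counting) a positive proportion of all maps into \<open>G\<close> send every
  hyperedge to a light set. Only \<open>O(n\<^bsup>k-1\<^esup> s)\<close> of the \<open>n\<^sup>k\<close> maps are degenerate, so one of them extends
  to an embedding of \<open>H\<close>.
\<close>

section \<open>Energy of a partition\<close>

text \<open>The conditional expectation of \<open>f\<close> given \<open>g\<close> for the uniform
  distribution on \<open>X\<close>. If no point of \<open>X\<close> shares the label of
  \<open>x\<close>, the division by zero gives 0.\<close>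

definition fibre_avg :: "'x set \<Rightarrow> ('x \<Rightarrow> 'l) \<Rightarrow> ('x \<Rightarrow> real) \<Rightarrow> 'x \<Rightarrow> real" where
  "fibre_avg X g f x = (\<Sum>y | y \<in> X \<and> g y = g x. f y) / real (card {y \<in> X. g y = g x})"

lemma fibre_avg_cong:
  "g x = g y \<Longrightarrow> fibre_avg X g f x = fibre_avg X g f y"
  unfolding fibre_avg_def by simp

lemma fibre_avg_bounds:
  assumes "finite X" "\<And>y. y \<in> X \<Longrightarrow> 0 \<le> f y \<and> f y \<le> 1"
  shows "0 \<le> fibre_avg X g f x" "fibre_avg X g f x \<le> 1"
proof -
  have "(\<Sum>y | y \<in> X \<and> g y = g x. f y) \<le> (\<Sum>y | y \<in> X \<and> g y = g x. 1)"
    using assms by (intro sum_mono) auto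
  then show "fibre_avg X g f x \<le> 1"
    unfolding fibre_avg_def by (cases "card {y \<in> X. g y = g x} = 0") (auto simp: divide_le_eq_1)
  have "(\<Sum>y | y \<in> X \<and> g y = g x. f y) \<ge> 0"
    using assms by (intro sum_nonneg) auto
  then show "0 \<le> fibre_avg X g f x" unfolding fibre_avg_def by simp
qed

lemma sum_fibres:
  fixes h :: "'x \<Rightarrow> real"
  assumes "finite X"
  shows "(\<Sum>x\<in>X. h x) = (\<Sum>l\<in>g ` X. \<Sum>x | x \<in> X \<and> g x = l. h x)"
  using sum.image_gen[OF assms, of h g] by simp

text \<open>The defining property of conditional expectation: a weight that is constant on fibres
  can be pulled out of each fibre sum, and over a fibre the average has the same sum as
  \<open>f\<close>.\<close>

lemma sum_mult_fibre_avg: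
  fixes h :: "'x \<Rightarrow> real"
  assumes "finite X" and h: "\<And>x y. x \<in> X \<Longrightarrow> y \<in> X \<Longrightarrow> g x = g y \<Longrightarrow> h x = h y"
  shows "(\<Sum>x\<in>X. h x * fibre_avg X g f x) = (\<Sum>x\<in>X. h x * f x)"
proof -
  have "(\<Sum>x | x \<in> X \<and> g x = l. h x * fibre_avg X g f x) = (\<Sum>x | x \<in> X \<and> g x = l. h x * f x)"
    if "l \<in> g ` X" for l
  proof -
    obtain z where z: "z \<in> X" "l = g z" using \<open>l \<in> g ` X\<close> by auto
    let ?C = "{x \<in> X. g x = g z}"
    have "card ?C \<noteq> 0" using assms(1) z by auto
    have "(\<Sum>x\<in>?C. h x * fibre_avg X g f x) = (\<Sum>x\<in>?C. h z * fibre_avg X g f z)"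
      
    proof (rule sum.cong[OF refl])
      fix x assume x: "x \<in> ?C"
      then have "h x = h z" using h z(1) by blast
      moreover have "fibre_avg X g f x = fibre_avg X g f z"
        using x by (intro fibre_avg_cong) simp
      ultimately show "h x * fibre_avg X g f x = h z * fibre_avg X g f z" by simp
    qed
    also have "\<dots> = h z * (\<Sum>x\<in>?C. f x)"
      using \<open>card ?C \<noteq> 0\<close> by (simp add: fibre_avg_def)
    also have "\<dots> = (\<Sum>x\<in>?C. h x * f x)"
      unfolding sum_distrib_left
    proof (rule sum.cong[OF refl])
      fix x assume "x \<in> ?C"
      then have "h x = h z" using h z(1) by blast
      then show "h z * f x = h x * f x" by simp
    qed
    finally show ?thesis by (simp add: z)
  qed
  then show ?thesis
    unfolding sum_fibres[OF assms(1), of "\<lambda>x. h x * fibre_avg X g f x" g]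
      sum_fibres[OF assms(1), of "\<lambda>x. h x * f x" g]
    by (rule sum.cong[OF refl])
qed

text \<open>The squared L2 norm of the conditional expectation. It is a sum rather than a mean, so
  for \<open>f\<close> with values in [0,1] it is bounded by the number of points.\<close>

definition energy :: "'x set \<Rightarrow> ('x \<Rightarrow> 'l) \<Rightarrow> ('x \<Rightarrow> real) \<Rightarrow> real" where
  "energy X g f = (\<Sum>x\<in>X. (fibre_avg X g f x)\<^sup>2)"

lemma energy_le:
  assumes "finite X" "\<And>y. y \<in> X \<Longrightarrow> 0 \<le> f y \<and> f y \<le> 1"
  shows "energy X g f \<le> real (card X)"
proof -
  have "energy X g f \<le> (\<Sum>x\<in>X. 1)"
    unfolding energy_def using fibre_avg_bounds[of X f g, OF assms]
    by (intro sum_mono) (simp add: power_le_one)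
  then show ?thesis by simp
qed

text \<open>Pythagoras for nested projections: the coarse average is constant on the fine fibres, so
  its product with the fine average, like its product with itself, sums to its product with
  \<open>f\<close>. The cross term of the expanded square is therefore twice the coarse
  energy.\<close>

lemma energy_refine:
  assumes "finite X" and ref: "\<And>x y. x \<in> X \<Longrightarrow> y \<in> X \<Longrightarrow> g' x = g' y \<Longrightarrow> g x = g y"
  shows "energy X g' f = energy X g f + (\<Sum>x\<in>X. (fibre_avg X g' f x - fibre_avg X g f x)\<^sup>2)"
proof -
  have 1: "(\<Sum>x\<in>X. fibre_avg X g f x * fibre_avg X g' f x) = (\<Sum>x\<in>X. fibre_avg X g f x * f x)"
    using ref by (intro sum_mult_fibre_avg assms(1)) (auto intro: fibre_avg_cong)
  have 2: "(\<Sum>x\<in>X. fibre_avg X g f x * fibre_avg X g f x) = (\<Sum>x\<in>X. fibre_avg X g f x * f x)"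
    by (intro sum_mult_fibre_avg assms(1)) (auto intro: fibre_avg_cong)
  have "(\<Sum>x\<in>X. (fibre_avg X g' f x - fibre_avg X g f x)\<^sup>2)
     = energy X g' f - 2 * (\<Sum>x\<in>X. fibre_avg X g f x * fibre_avg X g' f x) + energy X g f"
    unfolding energy_def sum_distrib_left sum_subtractf[symmetric] sum.distrib[symmetric]
    by (intro sum.cong refl) (simp add: power2_eq_square algebra_simps)
  also have "\<dots> = energy X g' f - energy X g f"
    using 1 2 by (simp add: energy_def power2_eq_square)
  finally show ?thesis by simp
qed

text \<open>As \<open>D\<close> is a union of fibres of \<open>g'\<close>, the function
  \<open>f\<close> and its fine average have the same sum over \<open>D\<close>. A large discrepancy
  of \<open>f\<close> on \<open>D\<close> is thus a large sum of the difference \<open>q\<close> of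
  the two averages, and by Cauchy-Schwarz the squares of \<open>q\<close> amount to at least
  \<epsilon>^2 per point of the fibre. Since \<open>M\<close> is a union of fibres, these gains add
  up, and \<open>energy_refine\<close> turns them into energy.\<close>

lemma energy_increment:
  assumes "finite X" and ref: "\<And>x y. x \<in> X \<Longrightarrow> y \<in> X \<Longrightarrow> g' x = g' y \<Longrightarrow> g x = g y"
    and "\<epsilon> \<ge> 0" and "M \<subseteq> X"
    and M_union: "\<And>x y. x \<in> M \<Longrightarrow> y \<in> X \<Longrightarrow> g x = g y \<Longrightarrow> y \<in> M"
    and wit: "\<And>x. x \<in> M \<Longrightarrow> \<exists>D. D \<subseteq> {y \<in> X. g y = g x} \<and>
        (\<forall>y\<in>D. \<forall>z\<in>X. g' y = g' z \<longrightarrow> z \<in> D) \<and>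
        \<bar>\<Sum>y\<in>D. f y - fibre_avg X g f x\<bar> \<ge> \<epsilon> * real (card {y \<in> X. g y = g x})"
  shows "energy X g' f \<ge> energy X g f + \<epsilon>\<^sup>2 * real (card M)"
proof -
  define q where "q x = fibre_avg X g' f x - fibre_avg X g f x" for x
  have finM: "finite M" using assms(1,4) finite_subset by blast
  have fib: "(\<Sum>x | x \<in> M \<and> g x = l. (q x)\<^sup>2) \<ge> (\<Sum>x | x \<in> M \<and> g x = l. \<epsilon>\<^sup>2)"
    if "l \<in> g ` M" for l
  proof -
    obtain x where x: "x \<in> M" "l = g x" using \<open>l \<in> g ` M\<close> by auto
    define C where "C = {y \<in> X. g y = g x}"
    obtain D where D: "D \<subseteq> C" "\<And>y z. y \<in> D \<Longrightarrow> z \<in> X \<Longrightarrow> g' y = g' z \<Longrightarrow> z \<in> D"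
      "\<bar>\<Sum>y\<in>D. f y - fibre_avg X g f x\<bar> \<ge> \<epsilon> * real (card C)"
      using wit[OF x(1)] unfolding C_def by blast
    have finC: "finite C" unfolding C_def using assms(1) by simp
    have CM: "{y. y \<in> M \<and> g y = l} = C"
      using M_union[OF x(1)] x \<open>M \<subseteq> X\<close> unfolding C_def by auto
    have DX: "D \<subseteq> X" using D(1) unfolding C_def by auto
    have finD: "finite D" using D(1) finC finite_subset by blast
    have Cpos: "card C > 0" using finC x \<open>M \<subseteq> X\<close> unfolding C_def by (auto simp: card_gt_0_iff)
    have "(\<Sum>y\<in>X. of_bool (y \<in> D) * fibre_avg X g' f y) = (\<Sum>y\<in>X. of_bool (y \<in> D) * f y)"
    proof (intro sum_mult_fibre_avg assms(1))
      fix y z assume "y \<in> X" "z \<in> X" "g' y = g' z"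
      then have "y \<in> D \<longleftrightarrow> z \<in> D" using D(2)[of y z] D(2)[of z y] by auto
      then show "of_bool (y \<in> D) = (of_bool (z \<in> D) :: real)" by simp
    qed
    moreover have "(\<Sum>y\<in>X. of_bool (y \<in> D) * h y) = (\<Sum>y\<in>D. h y)" for h :: "'a \<Rightarrow> real"
      using assms(1) DX by (intro sum.mono_neutral_cong_right) auto
    ultimately have "(\<Sum>y\<in>D. fibre_avg X g' f y) = (\<Sum>y\<in>D. f y)" by simp
    moreover have "fibre_avg X g f y = fibre_avg X g f x" if "y \<in> D" for y
      using that D(1) unfolding C_def by (intro fibre_avg_cong) auto
    ultimately have "(\<Sum>y\<in>D. q y) = (\<Sum>y\<in>D. f y - fibre_avg X g f x)"
      unfolding q_def by (simp add: sum_subtractf)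
    then have "\<epsilon> * real (card C) \<le> \<bar>\<Sum>y\<in>D. q y\<bar>" using D(3) by simp
    then have "(\<epsilon> * real (card C))\<^sup>2 \<le> (\<Sum>y\<in>D. q y)\<^sup>2"
      using \<open>\<epsilon> \<ge> 0\<close> by (metis abs_le_square_iff abs_of_nonneg mult_nonneg_nonneg of_nat_0_le_iff)
    also have "\<dots> = (\<Sum>y\<in>D. 1 * q y)\<^sup>2" by simp
    also have "\<dots> \<le> (\<Sum>y\<in>D. 1\<^sup>2) * (\<Sum>y\<in>D. (q y)\<^sup>2)"
      by (rule Cauchy_Schwarz_ineq_sum)
    \<comment> \<open>Both factors are enlarged from \<open>D\<close> to the fibre \<open>C\<close>,
      so that one \<open>card C\<close> cancels.\<close>
    also have "\<dots> \<le> real (card C) * (\<Sum>y\<in>C. (q y)\<^sup>2)"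
      using D(1) finC by (intro mult_mono sum_mono2) (auto simp: card_mono sum_nonneg)
    finally have "real (card C) * (\<epsilon>\<^sup>2 * real (card C)) \<le> real (card C) * (\<Sum>y\<in>C. (q y)\<^sup>2)"
      by (simp add: power2_eq_square mult_ac)
    then have "\<epsilon>\<^sup>2 * real (card C) \<le> (\<Sum>y\<in>C. (q y)\<^sup>2)"
      using Cpos by simp
    then show ?thesis unfolding CM by (simp add: mult.commute)
  qed
  have "\<epsilon>\<^sup>2 * real (card M) = (\<Sum>x\<in>M. \<epsilon>\<^sup>2)" by simp
  also have "\<dots> \<le> (\<Sum>x\<in>M. (q x)\<^sup>2)"
    unfolding sum_fibres[OF finM, of "\<lambda>_. \<epsilon>\<^sup>2" g] sum_fibres[OF finM, of "\<lambda>x. (q x)\<^sup>2" g]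
    by (rule sum_mono) (rule fib)
  also have "\<dots> \<le> (\<Sum>x\<in>X. (q x)\<^sup>2)"
    using assms(1,4) by (intro sum_mono2) auto
  finally have "\<epsilon>\<^sup>2 * real (card M) \<le> (\<Sum>x\<in>X. (q x)\<^sup>2)" .
  moreover have "energy X g' f = energy X g f + (\<Sum>x\<in>X. (q x)\<^sup>2)"
    unfolding q_def by (rule energy_refine[OF assms(1) ref])
  ultimately show ?thesis by simp
qed

section \<open>Regularity for uniform hypergraphs\<close>

text \<open>A partition of \<open>V\<close> is given by a family \<open>S\<close> of subsets: its parts are the atoms
  \<open>cell V S v\<close> of the algebra generated by \<open>S\<close>, so that refining means enlarging \<open>S\<close>.
  The discrepancy of a box is measured against the size of the whole cell box, not of the sub-box;
  sub-boxes thus need no lower bound on their size.\<close>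

definition sig :: "'v set set \<Rightarrow> 'v \<Rightarrow> 'v set set" where
  "sig S v = {T \<in> S. v \<in> T}"

definition cell :: "'v set \<Rightarrow> 'v set set \<Rightarrow> 'v \<Rightarrow> 'v set" where
  "cell V S v = {u \<in> V. sig S u = sig S v}"

text \<open>Restricting to \<open>E\<close> makes two labels equal exactly when the signatures agree
  on \<open>E\<close>; inside the product the fibres are then the boxes of cells.\<close>

definition tuple_sig :: "'i set \<Rightarrow> 'v set set \<Rightarrow> ('i \<Rightarrow> 'v) \<Rightarrow> 'i \<Rightarrow> 'v set set" where
  "tuple_sig E S x = (\<lambda>i\<in>E. sig S (x i))"

definition irregular ::
  "'v set \<Rightarrow> 'v set set \<Rightarrow> 'i set \<Rightarrow> (('i \<Rightarrow> 'v) \<Rightarrow> real) \<Rightarrow> real \<Rightarrow> ('i \<Rightarrow> 'v) set" where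
  "irregular V S E f \<epsilon> = {x \<in> PiE E (\<lambda>_. V). \<exists>U. (\<forall>i\<in>E. U i \<subseteq> cell V S (x i)) \<and>
     \<bar>\<Sum>y\<in>PiE E U. f y - fibre_avg (PiE E (\<lambda>_. V)) (tuple_sig E S) f x\<bar>
       \<ge> \<epsilon> * real (card (PiE E (\<lambda>i. cell V S (x i))))}"

lemma tuple_sig_eq_iff:
  "tuple_sig E S x = tuple_sig E S y \<longleftrightarrow> (\<forall>i\<in>E. sig S (x i) = sig S (y i))"
  unfolding tuple_sig_def restrict_def fun_eq_iff by auto

lemma tuple_fibre_eq:
  "{y \<in> PiE E (\<lambda>_. V). tuple_sig E S y = tuple_sig E S x} = PiE E (\<lambda>i. cell V S (x i))"
  unfolding tuple_sig_eq_iff cell_def PiE_def Pi_def by auto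

lemma sig_refine: "S \<subseteq> S' \<Longrightarrow> sig S' u = sig S' v \<Longrightarrow> sig S u = sig S v"
  unfolding sig_def by blast

text \<open>Whether a box witnesses irregularity depends only on the signature of the tuple, so one
  witness is chosen for each of at most \<open>(2 ^ card S) ^ card E\<close> signatures. The number
  of sides is thereby bounded independently of \<open>V\<close>.\<close>

lemma irregular_witnesses:
  fixes E :: "'i set" and V :: "'v set"
  assumes "finite E" "finite S"
  obtains W where "finite W" "card W \<le> (2 ^ card S) ^ card E * card E"
    and "\<And>x. x \<in> irregular V S E f \<epsilon> \<Longrightarrow> \<exists>U. (\<forall>i\<in>E. U i \<in> W \<and> U i \<subseteq> cell V S (x i)) \<and>
     \<bar>\<Sum>y\<in>PiE E U. f y - fibre_avg (PiE E (\<lambda>_. V)) (tuple_sig E S) f x\<bar>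
       \<ge> \<epsilon> * real (card (PiE E (\<lambda>i. cell V S (x i))))"
proof -
  define X where "X = PiE E (\<lambda>_. V)"
  define good where "good x U \<longleftrightarrow> (\<forall>i\<in>E. U i \<subseteq> cell V S (x i)) \<and>
     \<bar>\<Sum>y\<in>PiE E U. f y - fibre_avg X (tuple_sig E S) f x\<bar>
       \<ge> \<epsilon> * real (card (PiE E (\<lambda>i. cell V S (x i))))" for x :: "'i \<Rightarrow> 'v" and U
  define M where "M = irregular V S E f \<epsilon>"
  have M: "M = {x \<in> X. \<exists>U. good x U}"
    unfolding M_def irregular_def good_def X_def ..
  have good_cong: "good x U \<longleftrightarrow> good y U" if "tuple_sig E S x = tuple_sig E S y" for x y U
  proof -
    have "fibre_avg X (tuple_sig E S) f x = fibre_avg X (tuple_sig E S) f y"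
      by (rule fibre_avg_cong[of "tuple_sig E S" x y, OF that])
    moreover have "cell V S (x i) = cell V S (y i)" if "i \<in> E" for i
      using \<open>tuple_sig E S x = tuple_sig E S y\<close> that unfolding tuple_sig_eq_iff cell_def by auto
    moreover have "PiE E (\<lambda>i. cell V S (x i)) = PiE E (\<lambda>i. cell V S (y i))"
      using calculation(2) by (intro PiE_cong) auto
    ultimately show ?thesis unfolding good_def by simp
  qed
  have "\<forall>l\<in>tuple_sig E S ` M. \<exists>U. \<forall>x. tuple_sig E S x = l \<longrightarrow> good x U"
    unfolding M using good_cong by blast
  then obtain U where U: "\<And>l x. l \<in> tuple_sig E S ` M \<Longrightarrow> tuple_sig E S x = l \<Longrightarrow> good x (U l)"
    by metis
  define W where "W = (\<Union>l\<in>tuple_sig E S ` M. U l ` E)"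
  have sub: "tuple_sig E S ` M \<subseteq> PiE E (\<lambda>_. Pow S)"
    unfolding tuple_sig_def sig_def by auto
  have fin: "finite (PiE E (\<lambda>_. Pow S))" using assms by (intro finite_PiE) auto
  have fl: "finite (tuple_sig E S ` M)" using sub fin finite_subset by blast
  have cl: "card (tuple_sig E S ` M) \<le> (2 ^ card S) ^ card E"
    using card_mono[OF fin sub] assms by (simp add: card_PiE card_Pow)
  have "card W \<le> (\<Sum>l\<in>tuple_sig E S ` M. card (U l ` E))"
    unfolding W_def by (rule card_UN_le[OF fl])
  also have "\<dots> \<le> (\<Sum>l\<in>tuple_sig E S ` M. card E)"
    by (intro sum_mono card_image_le assms)
  also have "\<dots> \<le> (2 ^ card S) ^ card E * card E" using cl by simp
  finally have "card W \<le> (2 ^ card S) ^ card E * card E" .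
  moreover have "finite W" unfolding W_def by (intro finite_UN_I fl finite_imageI assms)
  moreover have "\<exists>U. (\<forall>i\<in>E. U i \<in> W \<and> U i \<subseteq> cell V S (x i)) \<and>
     \<bar>\<Sum>y\<in>PiE E U. f y - fibre_avg X (tuple_sig E S) f x\<bar>
       \<ge> \<epsilon> * real (card (PiE E (\<lambda>i. cell V S (x i))))" if "x \<in> M" for x
  proof -
    have "tuple_sig E S x \<in> tuple_sig E S ` M" using that by blast
    then have "good x (U (tuple_sig E S x))" "\<forall>i\<in>E. U (tuple_sig E S x) i \<in> W"
      using U unfolding W_def by blast+
    then show ?thesis unfolding good_def by blast
  qed
  ultimately show thesis using that[of W] unfolding M_def X_def by blast
qed

text \<open>Once the sides of the witness boxes belong to \<open>S'\<close>, membership in a side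
  can be read off the \<open>S'\<close>-signature. Each box is then a union of fibres of the finer
  labelling, as \<open>energy_increment\<close> demands of its \<open>D\<close>.\<close>

lemma tuple_energy_increment:
  assumes "finite E" "finite V" "S \<subseteq> S'" "\<epsilon> \<ge> 0"
    and W: "\<And>x. x \<in> irregular V S E f \<epsilon> \<Longrightarrow> \<exists>U. (\<forall>i\<in>E. U i \<in> S' \<and> U i \<subseteq> cell V S (x i)) \<and>
     \<bar>\<Sum>y\<in>PiE E U. f y - fibre_avg (PiE E (\<lambda>_. V)) (tuple_sig E S) f x\<bar>
       \<ge> \<epsilon> * real (card (PiE E (\<lambda>i. cell V S (x i))))"
  shows "energy (PiE E (\<lambda>_. V)) (tuple_sig E S') f
    \<ge> energy (PiE E (\<lambda>_. V)) (tuple_sig E S) f + \<epsilon>\<^sup>2 * real (card (irregular V S E f \<epsilon>))"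
proof (rule energy_increment)
  show "finite (PiE E (\<lambda>_. V))" using assms by (intro finite_PiE) auto
  show "tuple_sig E S x = tuple_sig E S y" if "tuple_sig E S' x = tuple_sig E S' y" for x y
    using that sig_refine[OF assms(3)] unfolding tuple_sig_eq_iff by blast
  show "irregular V S E f \<epsilon> \<subseteq> PiE E (\<lambda>_. V)" unfolding irregular_def by blast
  show "y \<in> irregular V S E f \<epsilon>"
    if "x \<in> irregular V S E f \<epsilon>" "y \<in> PiE E (\<lambda>_. V)" "tuple_sig E S x = tuple_sig E S y" for x y
  proof -
    have "fibre_avg (PiE E (\<lambda>_. V)) (tuple_sig E S) f x = fibre_avg (PiE E (\<lambda>_. V)) (tuple_sig E S) f y"
      by (rule fibre_avg_cong[of "tuple_sig E S" x y, OF that(3)])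
    moreover have c: "cell V S (x i) = cell V S (y i)" if "i \<in> E" for i
      using \<open>tuple_sig E S x = tuple_sig E S y\<close> that unfolding tuple_sig_eq_iff cell_def by auto
    moreover have "PiE E (\<lambda>i. cell V S (x i)) = PiE E (\<lambda>i. cell V S (y i))"
      using c by (intro PiE_cong) auto
    ultimately show ?thesis using that(1,2) unfolding irregular_def by auto
  qed
  show "\<exists>D. D \<subseteq> {y \<in> PiE E (\<lambda>_. V). tuple_sig E S y = tuple_sig E S x} \<and>
        (\<forall>y\<in>D. \<forall>z\<in>PiE E (\<lambda>_. V). tuple_sig E S' y = tuple_sig E S' z \<longrightarrow> z \<in> D) \<and>
        \<bar>\<Sum>y\<in>D. f y - fibre_avg (PiE E (\<lambda>_. V)) (tuple_sig E S) f x\<bar>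
          \<ge> \<epsilon> * real (card {y \<in> PiE E (\<lambda>_. V). tuple_sig E S y = tuple_sig E S x})"
    if "x \<in> irregular V S E f \<epsilon>" for x
  proof -
    obtain U where U: "\<And>i. i \<in> E \<Longrightarrow> U i \<in> S'" "\<And>i. i \<in> E \<Longrightarrow> U i \<subseteq> cell V S (x i)"
     "\<bar>\<Sum>y\<in>PiE E U. f y - fibre_avg (PiE E (\<lambda>_. V)) (tuple_sig E S) f x\<bar>
       \<ge> \<epsilon> * real (card (PiE E (\<lambda>i. cell V S (x i))))"
      using W[OF \<open>x \<in> irregular V S E f \<epsilon>\<close>] by blast
    have "PiE E U \<subseteq> PiE E (\<lambda>i. cell V S (x i))" using U(2) by (intro PiE_mono) auto
    moreover have "z \<in> PiE E U" if "y \<in> PiE E U" "z \<in> PiE E (\<lambda>_. V)"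
      "tuple_sig E S' y = tuple_sig E S' z" for y z
    proof -
      have "z i \<in> U i" if "i \<in> E" for i
      proof -
        have "U i \<in> sig S' (y i)" using U(1)[OF that] \<open>y \<in> PiE E U\<close> that unfolding sig_def by auto
        then have "U i \<in> sig S' (z i)"
          using \<open>tuple_sig E S' y = tuple_sig E S' z\<close> that unfolding tuple_sig_eq_iff by auto
        then show ?thesis unfolding sig_def by auto
      qed
      then show ?thesis using that(2) by (auto simp: PiE_iff)
    qed
    then have "\<forall>y\<in>PiE E U. \<forall>z\<in>PiE E (\<lambda>_. V). tuple_sig E S' y = tuple_sig E S' z \<longrightarrow> z \<in> PiE E U"
      by blast
    ultimately show ?thesis using U(3) unfolding tuple_fibre_eq by (intro exI[of _ "PiE E U"] conjI)
  qed
qed (use assms in auto)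

text \<open>The witnesses of all \<open>b\<close> are adjoined at once, giving one common family;
  the sets added for one \<open>b\<close> cannot lower the energy of another, as refinement never
  does.\<close>

lemma regularity_step:
  fixes V :: "'v set" and E :: "'b \<Rightarrow> 'i set"
  assumes "finite V" "finite S" "finite B" "\<And>b. b \<in> B \<Longrightarrow> finite (E b) \<and> card (E b) = r" "\<epsilon> \<ge> 0"
  shows "\<exists>S'. finite S' \<and> card S' \<le> card S + card B * ((2 ^ card S) ^ r * r) \<and>
    (\<Sum>b\<in>B. energy (PiE (E b) (\<lambda>_. V)) (tuple_sig (E b) S') (f b))
    \<ge> (\<Sum>b\<in>B. energy (PiE (E b) (\<lambda>_. V)) (tuple_sig (E b) S) (f b))
       + \<epsilon>\<^sup>2 * (\<Sum>b\<in>B. real (card (irregular V S (E b) (f b) \<epsilon>)))"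
proof -
  have "\<forall>b\<in>B. \<exists>W. finite W \<and> card W \<le> (2 ^ card S) ^ r * r \<and>
     (\<forall>x\<in>irregular V S (E b) (f b) \<epsilon>. \<exists>U. (\<forall>i\<in>E b. U i \<in> W \<and> U i \<subseteq> cell V S (x i)) \<and>
     \<bar>\<Sum>y\<in>PiE (E b) U. f b y - fibre_avg (PiE (E b) (\<lambda>_. V)) (tuple_sig (E b) S) (f b) x\<bar>
       \<ge> \<epsilon> * real (card (PiE (E b) (\<lambda>i. cell V S (x i)))))" (is "\<forall>b\<in>B. \<exists>W. ?P b W")
  proof
    fix b assume b: "b \<in> B"
    then have fE: "finite (E b)" "card (E b) = r" using assms(4) by auto
    show "\<exists>W. ?P b W"
      by (rule irregular_witnesses[OF fE(1) assms(2), where V=V and f="f b" and \<epsilon>=\<epsilon>])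
        (use fE(2) in blast)
  qed
  then obtain W where W: "\<And>b. b \<in> B \<Longrightarrow> ?P b (W b)" by metis
  define S' where "S' = S \<union> (\<Union>b\<in>B. W b)"
  have "finite S'" unfolding S'_def using assms W by auto
  moreover have "card S' \<le> card S + card B * ((2 ^ card S) ^ r * r)"
  proof -
    have "card S' \<le> card S + card (\<Union>b\<in>B. W b)" unfolding S'_def by (rule card_Un_le)
    also have "card (\<Union>b\<in>B. W b) \<le> (\<Sum>b\<in>B. card (W b))" by (rule card_UN_le[OF assms(3)])
    also have "\<dots> \<le> (\<Sum>b\<in>B. (2 ^ card S) ^ r * r)" using W by (intro sum_mono) blast
    finally show ?thesis by simp
  qed
  moreover have "(\<Sum>b\<in>B. energy (PiE (E b) (\<lambda>_. V)) (tuple_sig (E b) S) (f b)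
       + \<epsilon>\<^sup>2 * real (card (irregular V S (E b) (f b) \<epsilon>)))
    \<le> (\<Sum>b\<in>B. energy (PiE (E b) (\<lambda>_. V)) (tuple_sig (E b) S') (f b))"
  proof (rule sum_mono)
    fix b assume b: "b \<in> B"
    have "W b \<subseteq> S'" unfolding S'_def using b by blast
    show "energy (PiE (E b) (\<lambda>_. V)) (tuple_sig (E b) S) (f b)
       + \<epsilon>\<^sup>2 * real (card (irregular V S (E b) (f b) \<epsilon>))
       \<le> energy (PiE (E b) (\<lambda>_. V)) (tuple_sig (E b) S') (f b)"
    proof (rule tuple_energy_increment)
      fix x assume "x \<in> irregular V S (E b) (f b) \<epsilon>"
      then obtain U where "\<forall>i\<in>E b. U i \<in> W b \<and> U i \<subseteq> cell V S (x i)"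
        "\<bar>\<Sum>y\<in>PiE (E b) U. f b y - fibre_avg (PiE (E b) (\<lambda>_. V)) (tuple_sig (E b) S) (f b) x\<bar>
         \<ge> \<epsilon> * real (card (PiE (E b) (\<lambda>i. cell V S (x i))))"
        using W[OF b] by blast
      then show "\<exists>U. (\<forall>i\<in>E b. U i \<in> S' \<and> U i \<subseteq> cell V S (x i)) \<and>
        \<bar>\<Sum>y\<in>PiE (E b) U. f b y - fibre_avg (PiE (E b) (\<lambda>_. V)) (tuple_sig (E b) S) (f b) x\<bar>
         \<ge> \<epsilon> * real (card (PiE (E b) (\<lambda>i. cell V S (x i))))"
        using \<open>W b \<subseteq> S'\<close> by (intro exI[of _ U]) auto
    qed (use assms(4)[OF b] assms(1,5) in \<open>auto simp: S'_def\<close>)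
  qed
  ultimately show ?thesis by (auto simp: sum.distrib sum_distrib_left)
qed

text \<open>Energy iteration: as long as the irregular tuples are too many, each step adds at least
  \<epsilon>^2 \<eta> |V|^r to a total energy that never exceeds |B| |V|^r. The number of steps, and
  hence \<open>K\<close>, depends neither on \<open>V\<close> nor on \<open>f\<close>.\<close>

theorem hypergraph_regularity:
  fixes B :: "'b set" and E :: "'b \<Rightarrow> 'i set"
  assumes "finite B" "\<And>b. b \<in> B \<Longrightarrow> finite (E b) \<and> card (E b) = r" "\<epsilon> > 0" "\<eta> > 0" "r > 0"
  obtains K where "\<And>(V :: 'v set) (f :: 'b \<Rightarrow> ('i \<Rightarrow> 'v) \<Rightarrow> real).
    finite V \<Longrightarrow> (\<And>b x. b \<in> B \<Longrightarrow> 0 \<le> f b x \<and> f b x \<le> 1) \<Longrightarrow>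
    \<exists>S. finite S \<and> card S \<le> K \<and>
      (\<Sum>b\<in>B. real (card (irregular V S (E b) (f b) \<epsilon>))) \<le> \<eta> * real (card V) ^ r"
proof -
  \<comment> \<open>\<open>g k\<close> bounds the size of the family after \<open>k\<close> steps
    from the empty one, by iterating the bound of \<open>regularity_step\<close>.\<close>
  define g where "g = rec_nat 0 (\<lambda>_ c. c + card B * ((2 ^ c) ^ r * r))"
  have g_Suc: "g (Suc n) = g n + card B * ((2 ^ g n) ^ r * r)" for n
    by (simp add: g_def)
  have "mono (\<lambda>c. c + card B * ((2 ^ c) ^ r * r))"
    by (intro monoI add_mono mult_mono power_mono power_increasing) auto
  then have g_bound: "c + card B * ((2 ^ c) ^ r * r) \<le> g (Suc n)" if "c \<le> g n" for c n
    using that unfolding g_Suc by (auto dest: monoD)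
  \<comment> \<open>After \<open>n\<close> increments the energy would exceed its maximum.\<close>
  obtain n :: nat where n: "real n * (\<epsilon>\<^sup>2 * \<eta>) > real (card B)"
    using reals_Archimedean3[of "\<epsilon>\<^sup>2 * \<eta>"] assms(3,4) by auto
  show thesis
  proof (rule that[of "g n"])
    fix V :: "'v set" and f :: "'b \<Rightarrow> ('i \<Rightarrow> 'v) \<Rightarrow> real"
    assume V: "finite V" and f: "\<And>b x. b \<in> B \<Longrightarrow> 0 \<le> f b x \<and> f b x \<le> 1"
    define en where "en S = (\<Sum>b\<in>B. energy (PiE (E b) (\<lambda>_. V)) (tuple_sig (E b) S) (f b))" for S
    define reg where "reg S \<longleftrightarrow>
      (\<Sum>b\<in>B. real (card (irregular V S (E b) (f b) \<epsilon>))) \<le> \<eta> * real (card V) ^ r" for S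
    have cardX: "card (PiE (E b) (\<lambda>_. V)) = card V ^ r" if "b \<in> B" for b
      using assms(2)[OF that] by (simp add: card_PiE)
    have "\<exists>S. finite S \<and> card S \<le> g k \<and> (reg S \<or> en S \<ge> real k * (\<epsilon>\<^sup>2 * \<eta>) * real (card V) ^ r)" for k
    proof (induction k)
      case 0
      have "en {} \<ge> 0" unfolding en_def energy_def by (intro sum_nonneg) simp
      then show ?case by (intro exI[of _ "{}"]) (simp add: g_def)
    next
      case (Suc k)
      then obtain S where S: "finite S" "card S \<le> g k"
        "reg S \<or> en S \<ge> real k * (\<epsilon>\<^sup>2 * \<eta>) * real (card V) ^ r" by blast
      show ?case
      proof (cases "reg S")
        case True
        then show ?thesis using S(1,2) unfolding g_Suc by (intro exI[of _ S]) auto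
      next
        case False
        obtain S' where S': "finite S'" "card S' \<le> card S + card B * ((2 ^ card S) ^ r * r)"
          "en S' \<ge> en S + \<epsilon>\<^sup>2 * (\<Sum>b\<in>B. real (card (irregular V S (E b) (f b) \<epsilon>)))"
          using regularity_step[where f=f and \<epsilon>=\<epsilon> and E=E, OF V S(1) assms(1,2)] assms(3) unfolding en_def by auto
        have "\<epsilon>\<^sup>2 * (\<Sum>b\<in>B. real (card (irregular V S (E b) (f b) \<epsilon>))) \<ge> \<epsilon>\<^sup>2 * (\<eta> * real (card V) ^ r)"
          using False unfolding reg_def by (intro mult_left_mono) auto
        then have "en S' \<ge> real (Suc k) * (\<epsilon>\<^sup>2 * \<eta>) * real (card V) ^ r"
          using S'(3) S(3) False by (simp add: algebra_simps)
        moreover have "card S' \<le> g (Suc k)" using S'(2) g_bound[OF S(2)] by linarith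
        ultimately show ?thesis using S'(1) by blast
      qed
    qed
    then obtain S where S: "finite S" "card S \<le> g n"
      "reg S \<or> en S \<ge> real n * (\<epsilon>\<^sup>2 * \<eta>) * real (card V) ^ r" by blast
    have "reg S"
    proof (rule ccontr)
      assume nreg: "\<not> reg S"
      have "en S \<le> (\<Sum>b\<in>B. real (card (PiE (E b) (\<lambda>_. V))))"
        unfolding en_def using f V assms(2) by (intro sum_mono energy_le finite_PiE) auto
      also have "\<dots> = real (card B) * real (card V) ^ r" using cardX by simp
      finally have le: "real n * (\<epsilon>\<^sup>2 * \<eta>) * real (card V) ^ r \<le> real (card B) * real (card V) ^ r"
        using S(3) nreg by linarith
      \<comment> \<open>For empty \<open>V\<close> both sides of \<open>le\<close> vanish and there
        is no contradiction; but then no tuples exist, because \<open>r > 0\<close> makes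
        \<open>E b\<close> nonempty.\<close>
      have "card V \<noteq> 0"
      proof
        assume "card V = 0"
        then have "V = {}" using V by simp
        then have "irregular V S (E b) (f b) \<epsilon> = {}" if "b \<in> B" for b
        proof -
          have "E b \<noteq> {}" using assms(2)[OF that] \<open>r > 0\<close> by auto
          then have "PiE (E b) (\<lambda>_. V) = {}" using \<open>V = {}\<close> by (auto simp: PiE_eq_empty_iff)
          then show ?thesis unfolding irregular_def by simp
        qed
        then show False using nreg \<open>\<eta> > 0\<close> unfolding reg_def by simp
      qed
      then show False using le n by simp
    qed
    then show "\<exists>S. finite S \<and> card S \<le> g n \<and>
      (\<Sum>b\<in>B. real (card (irregular V S (E b) (f b) \<epsilon>))) \<le> \<eta> * real (card V) ^ r"
      using S unfolding reg_def by blast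
  qed
qed

section \<open>Counting homomorphisms of linear hypergraphs\<close>

lemma sum_PiE_split:
  fixes h :: "('i \<Rightarrow> 'v) \<Rightarrow> real"
  assumes "J \<subseteq> I"
  shows "(\<Sum>x\<in>PiE I C. h x)
    = (\<Sum>z\<in>PiE (I - J) C. \<Sum>y\<in>PiE J C. h (\<lambda>i. if i \<in> J then y i else z i))"
proof -
  have "(\<Sum>z\<in>PiE (I - J) C. \<Sum>y\<in>PiE J C. h (\<lambda>i. if i \<in> J then y i else z i))
    = (\<Sum>(z, y)\<in>PiE (I - J) C \<times> PiE J C. h (\<lambda>i. if i \<in> J then y i else z i))"
    by (rule sum.cartesian_product)
  also have "\<dots> = (\<Sum>x\<in>PiE I C. h x)"
  proof (rule sum.reindex_bij_witness[where i="\<lambda>x. (restrict x (I - J), restrict x J)"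
        and j="\<lambda>(z, y) i. if i \<in> J then y i else z i"])
    fix x assume x: "x \<in> PiE I C"
    show "(case (restrict x (I - J), restrict x J) of (z, y) \<Rightarrow> \<lambda>i. if i \<in> J then y i else z i) = x"
      using x assms by (auto simp: fun_eq_iff restrict_def PiE_def extensional_def)
    show "(restrict x (I - J), restrict x J) \<in> PiE (I - J) C \<times> PiE J C"
      using x assms by (auto simp: PiE_def Pi_def)
  next
    fix p assume "p \<in> PiE (I - J) C \<times> PiE J C"
    then obtain z y where p: "p = (z, y)" "z \<in> PiE (I - J) C" "y \<in> PiE J C" by auto
    show "(restrict (case p of (z, y) \<Rightarrow> \<lambda>i. if i \<in> J then y i else z i) (I - J),
        restrict (case p of (z, y) \<Rightarrow> \<lambda>i. if i \<in> J then y i else z i) J) = p"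
      using p by (auto simp: fun_eq_iff restrict_def PiE_def extensional_def)
    show "(case p of (z, y) \<Rightarrow> \<lambda>i. if i \<in> J then y i else z i) \<in> PiE I C"
      using p assms by (auto simp: PiE_def Pi_def extensional_def)
    show "h (case p of (z, y) \<Rightarrow> \<lambda>i. if i \<in> J then y i else z i)
      = (case p of (z, y) \<Rightarrow> h (\<lambda>i. if i \<in> J then y i else z i))"
      using p by simp
  qed
  finally show ?thesis by simp
qed

lemma card_PiE_split:
  assumes "J \<subseteq> I" "finite I"
  shows "card (PiE I C) = card (PiE (I - J) C) * card (PiE J C)"
proof -
  have "finite J" using assms finite_subset by blast
  then show ?thesis
    using assms prod.subset_diff[of J I "\<lambda>i. card (C i)"] by (simp add: card_PiE)
qed

text \<open>Once the coordinates outside \<open>E b\<close> are fixed, linearity makes each of the other constraints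
  depend on at most one coordinate in \<open>E b\<close>, so that they cut out a sub-box.\<close>

lemma linear_constraint_discrepancy:
  fixes P :: "'b \<Rightarrow> ('i \<Rightarrow> 'v) \<Rightarrow> bool"
  assumes "finite I" "E b \<subseteq> I" "\<And>i. i \<in> I \<Longrightarrow> finite (C i)"
    and lin: "\<And>b'. b' \<in> F \<Longrightarrow> card (E b' \<inter> E b) \<le> 1"
    and sub: "\<And>b'. b' \<in> F \<Longrightarrow> E b' \<subseteq> I"
    and box: "\<And>U. (\<And>i. i \<in> E b \<Longrightarrow> U i \<subseteq> C i) \<Longrightarrow>
       \<bar>\<Sum>y\<in>PiE (E b) U. of_bool (P b y) - \<delta>\<bar> \<le> \<epsilon> * real (card (PiE (E b) C))"
  shows "\<bar>\<Sum>x\<in>PiE I C. of_bool (\<forall>b'\<in>F. P b' (restrict x (E b'))) *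
      (of_bool (P b (restrict x (E b))) - \<delta>)\<bar> \<le> \<epsilon> * real (card (PiE I C))"
proof -
  define J where "J = E b"
  have fJ: "finite J" "J \<subseteq> I" unfolding J_def using assms(1,2) finite_subset by auto
  define mrg where "mrg z y = (\<lambda>i. if i \<in> J then y i else z i)" for z y :: "'i \<Rightarrow> 'v"
  define Q where "Q x \<longleftrightarrow> (\<forall>b'\<in>F. P b' (restrict x (E b')))" for x
  define h where "h x = of_bool (Q x) * (of_bool (P b (restrict x J)) - \<delta>)" for x
  have inner: "\<bar>\<Sum>y\<in>PiE J C. h (mrg z y)\<bar> \<le> \<epsilon> * real (card (PiE J C))" for z
  proof -
    \<comment> \<open>With \<open>z\<close> fixed, the edges that miss \<open>J\<close> amount to a
      single condition \<open>N\<close> on \<open>z\<close>. An edge through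
      \<open>i \<in> J\<close> meets \<open>J\<close> only in \<open>i\<close> by
      \<open>lin\<close>, and so merely restricts \<open>y i\<close> to \<open>U i\<close>.\<close>
    define N where "N \<longleftrightarrow> (\<forall>b'\<in>F. E b' \<inter> J = {} \<longrightarrow> P b' (restrict z (E b')))"
    define U where "U i = {u \<in> C i. \<forall>b'\<in>F. i \<in> E b' \<longrightarrow>
        P b' (restrict (\<lambda>k. if k \<in> J then u else z k) (E b'))}" for i
    have Q_iff: "Q (mrg z y) \<longleftrightarrow> N \<and> y \<in> PiE J U" if y: "y \<in> PiE J C" for y
    proof -
      have r0: "restrict (mrg z y) (E b') = restrict z (E b')" if "E b' \<inter> J = {}" for b'
        using that unfolding mrg_def restrict_def by (auto simp: fun_eq_iff)
      have r1: "restrict (mrg z y) (E b') = restrict (\<lambda>k. if k \<in> J then y i else z k) (E b')"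
        if "b' \<in> F" "i \<in> E b'" "i \<in> J" for b' i
      proof -
        have "finite (E b' \<inter> E b)" using fJ(1) unfolding J_def by simp
        then have "k = i" if "k \<in> E b'" "k \<in> J" for k
          using lin[OF \<open>b' \<in> F\<close>] that \<open>i \<in> E b'\<close> \<open>i \<in> J\<close> unfolding J_def card_le_Suc0_iff_eq[OF \<open>finite (E b' \<inter> E b)\<close>] One_nat_def by blast
        then show ?thesis unfolding mrg_def restrict_def fun_eq_iff by auto
      qed
      have "Q (mrg z y) \<longleftrightarrow> N \<and> (\<forall>b'\<in>F. \<forall>i\<in>E b' \<inter> J. P b' (restrict (mrg z y) (E b')))"
      proof
        assume "Q (mrg z y)"
        then show "N \<and> (\<forall>b'\<in>F. \<forall>i\<in>E b' \<inter> J. P b' (restrict (mrg z y) (E b')))"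
          unfolding Q_def N_def using r0 by metis
      next
        assume a: "N \<and> (\<forall>b'\<in>F. \<forall>i\<in>E b' \<inter> J. P b' (restrict (mrg z y) (E b')))"
        show "Q (mrg z y)" unfolding Q_def
        proof
          fix b' assume b': "b' \<in> F"
          show "P b' (restrict (mrg z y) (E b'))"
          proof (cases "E b' \<inter> J = {}")
            case True
            then show ?thesis using a b' r0 unfolding N_def by metis
          next
            case False
            then show ?thesis using a b' by blast
          qed
        qed
      qed
      also have "(\<forall>b'\<in>F. \<forall>i\<in>E b' \<inter> J. P b' (restrict (mrg z y) (E b'))) \<longleftrightarrow>
          (\<forall>i\<in>J. \<forall>b'\<in>F. i \<in> E b' \<longrightarrow> P b' (restrict (\<lambda>k. if k \<in> J then y i else z k) (E b')))"
      proof (intro iffI ballI impI)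
        fix i b' assume a: "\<forall>b'\<in>F. \<forall>i\<in>E b' \<inter> J. P b' (restrict (mrg z y) (E b'))"
          and "i \<in> J" "b' \<in> F" "i \<in> E b'"
        then have "P b' (restrict (mrg z y) (E b'))" by blast
        then show "P b' (restrict (\<lambda>k. if k \<in> J then y i else z k) (E b'))"
          unfolding r1[OF \<open>b' \<in> F\<close> \<open>i \<in> E b'\<close> \<open>i \<in> J\<close>] .
      next
        fix i b' assume a: "\<forall>i\<in>J. \<forall>b'\<in>F. i \<in> E b' \<longrightarrow>
            P b' (restrict (\<lambda>k. if k \<in> J then y i else z k) (E b'))"
          and "b' \<in> F" "i \<in> E b' \<inter> J"
        then have i: "i \<in> E b'" "i \<in> J" by auto
        show "P b' (restrict (mrg z y) (E b'))"
          unfolding r1[OF \<open>b' \<in> F\<close> i] using a \<open>b' \<in> F\<close> i by blast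
      qed
      also have "\<dots> \<longleftrightarrow> y \<in> PiE J U"
        using y unfolding U_def by (auto simp: PiE_iff)
      finally show ?thesis .
    qed
    have rJ: "restrict (mrg z y) J = y" if "y \<in> PiE J C" for y
      using that unfolding mrg_def by (auto simp: fun_eq_iff PiE_def extensional_def)
    have fin: "finite (PiE J C)" using fJ assms(3) by (intro finite_PiE) auto
    have UC: "PiE J U \<subseteq> PiE J C" unfolding U_def by (intro PiE_mono) auto
    have "(\<Sum>y\<in>PiE J C. h (mrg z y))
      = (\<Sum>y\<in>PiE J C. if N \<and> y \<in> PiE J U then of_bool (P b y) - \<delta> else 0)"
      by (intro sum.cong refl) (simp add: h_def Q_iff rJ)
    also have "\<dots> = (if N then \<Sum>y\<in>PiE J U. of_bool (P b y) - \<delta> else 0)"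
      using fin UC by (simp add: sum.inter_restrict[symmetric] Int_absorb1)
    finally have eq: "(\<Sum>y\<in>PiE J C. h (mrg z y)) = \<dots>" .
    have "\<bar>\<Sum>y\<in>PiE J U. of_bool (P b y) - \<delta>\<bar> \<le> \<epsilon> * real (card (PiE J C))"
      unfolding J_def by (rule box) (auto simp: U_def)
    moreover from this have "0 \<le> \<epsilon> * real (card (PiE J C))" by linarith
    ultimately show ?thesis unfolding eq by (cases N) simp_all
  qed
  have "\<bar>\<Sum>x\<in>PiE I C. h x\<bar> = \<bar>\<Sum>z\<in>PiE (I - J) C. \<Sum>y\<in>PiE J C. h (mrg z y)\<bar>"
    unfolding mrg_def by (simp add: sum_PiE_split[OF fJ(2)])
  also have "\<dots> \<le> (\<Sum>z\<in>PiE (I - J) C. \<epsilon> * real (card (PiE J C)))"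
    by (rule order_trans[OF sum_abs sum_mono[OF inner]])
  also have "\<dots> = \<epsilon> * real (card (PiE I C))"
    by (simp add: card_PiE_split[OF fJ(2) assms(1)])
  finally show ?thesis unfolding h_def Q_def J_def .
qed

text \<open>Induction on the edges. Among the tuples satisfying the earlier constraints, replacing
  the indicator of the new edge by its density costs at most \<epsilon> times the whole box, by
  \<open>linear_constraint_discrepancy\<close>. Each edge thus contributes a factor of at least
  \<open>d\<close> and one error term.\<close>

lemma linear_counting:
  fixes P :: "'b \<Rightarrow> ('i \<Rightarrow> 'v) \<Rightarrow> bool"
  assumes "finite I" "finite F" "\<And>b. b \<in> F \<Longrightarrow> E b \<subseteq> I" "\<And>i. i \<in> I \<Longrightarrow> finite (C i)"
    and "\<And>b b'. b \<in> F \<Longrightarrow> b' \<in> F \<Longrightarrow> b \<noteq> b' \<Longrightarrow> card (E b \<inter> E b') \<le> 1"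
    and "0 \<le> d" "d \<le> 1" "0 \<le> \<epsilon>" "\<And>b. b \<in> F \<Longrightarrow> d \<le> \<delta> b"
    and "\<And>b U. b \<in> F \<Longrightarrow> (\<And>i. i \<in> E b \<Longrightarrow> U i \<subseteq> C i) \<Longrightarrow>
       \<bar>\<Sum>y\<in>PiE (E b) U. of_bool (P b y) - \<delta> b\<bar> \<le> \<epsilon> * real (card (PiE (E b) C))"
  shows "real (card {x \<in> PiE I C. \<forall>b\<in>F. P b (restrict x (E b))})
    \<ge> (d ^ card F - real (card F) * \<epsilon>) * real (card (PiE I C))"
  using assms(2,3,5,9,10)
proof (induction F rule: finite_induct)
  case empty
  then show ?case by simp
next
  case (insert b F)
  define X where "X = PiE I C"
  have fX: "finite X" unfolding X_def using assms by (intro finite_PiE) auto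
  define Q where "Q x \<longleftrightarrow> (\<forall>b\<in>F. P b (restrict x (E b)))" for x
  have IH: "real (card {x \<in> X. Q x}) \<ge> (d ^ card F - real (card F) * \<epsilon>) * real (card X)"
    unfolding X_def Q_def
  proof (rule insert.IH)
    show "E b' \<subseteq> I" if "b' \<in> F" for b'
      by (rule insert.prems(1)) (use that in simp)
    show "card (E b' \<inter> E b'') \<le> 1" if "b' \<in> F" "b'' \<in> F" "b' \<noteq> b''" for b' b''
      by (rule insert.prems(2)) (use that in simp_all)
    show "d \<le> \<delta> b'" if "b' \<in> F" for b'
      by (rule insert.prems(3)) (use that in simp)
    show "\<bar>\<Sum>y\<in>PiE (E b') U. of_bool (P b' y) - \<delta> b'\<bar> \<le> \<epsilon> * real (card (PiE (E b') C))"
      if "b' \<in> F" "\<And>i. i \<in> E b' \<Longrightarrow> U i \<subseteq> C i" for b' U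
      by (rule insert.prems(4)) (use that in simp_all)
  qed
  have "\<bar>\<Sum>x\<in>X. of_bool (Q x) * (of_bool (P b (restrict x (E b))) - \<delta> b)\<bar> \<le> \<epsilon> * real (card X)"
    unfolding X_def Q_def
  proof (rule linear_constraint_discrepancy[OF assms(1)])
    show "card (E b' \<inter> E b) \<le> 1" if "b' \<in> F" for b'
      using insert.prems(2)[of b' b] insert.hyps(2) that by auto
    show "\<bar>\<Sum>y\<in>PiE (E b) U. of_bool (P b y) - \<delta> b\<bar> \<le> \<epsilon> * real (card (PiE (E b) C))"
      if "\<And>i. i \<in> E b \<Longrightarrow> U i \<subseteq> C i" for U
      by (rule insert.prems(4)) (use that in simp_all)
  qed (use insert.prems(1) assms(4) in simp_all)
  moreover have "real (card {x \<in> X. Q x \<and> P b (restrict x (E b))}) - \<delta> b * real (card {x \<in> X. Q x})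
     = (\<Sum>x\<in>X. of_bool (Q x) * (of_bool (P b (restrict x (E b))) - \<delta> b))"
  proof -
    have "real (card {x \<in> X. R x}) = (\<Sum>x\<in>X. of_bool (R x))" for R
      using fX by (simp add: sum_of_bool_eq Int_def)
    then show ?thesis
      by (simp add: sum_distrib_left sum_subtractf[symmetric] of_bool_conj algebra_simps)
  qed
  ultimately have "real (card {x \<in> X. Q x \<and> P b (restrict x (E b))})
     \<ge> \<delta> b * real (card {x \<in> X. Q x}) - \<epsilon> * real (card X)" by linarith
  moreover have "\<delta> b * real (card {x \<in> X. Q x}) \<ge> d * real (card {x \<in> X. Q x})"
    using insert.prems(3)[of b] by (intro mult_right_mono) auto
  moreover have "d * real (card {x \<in> X. Q x}) \<ge> d * ((d ^ card F - real (card F) * \<epsilon>) * real (card X))"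
    using IH assms by (intro mult_left_mono) auto
  \<comment> \<open>As \<open>d \<le> 1\<close>, multiplying by it does not enlarge the errors
    collected so far, and the total stays linear in the number of edges.\<close>
  moreover have "d * (real (card F) * \<epsilon>) * real (card X) \<le> 1 * (real (card F) * \<epsilon>) * real (card X)"
    using assms by (intro mult_right_mono) auto
  ultimately have "real (card {x \<in> X. Q x \<and> P b (restrict x (E b))})
     \<ge> (d ^ Suc (card F) - real (Suc (card F)) * \<epsilon>) * real (card X)"
    by (simp add: algebra_simps)
  moreover have "{x \<in> X. Q x \<and> P b (restrict x (E b))} = {x \<in> PiE I C. \<forall>b\<in>insert b F. P b (restrict x (E b))}"
    unfolding X_def Q_def by auto
  ultimately show ?case unfolding X_def card_insert_disjoint[OF insert.hyps(1,2)] by (simp only:)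
qed

section \<open>A removal lemma for linear hypergraphs\<close>

text \<open>A tuple in the set is determined by its restriction to \<open>I - {j}\<close> and one of
  at most \<open>s\<close> values at \<open>j\<close>. A constant \<open>F\<close> expresses
  membership of a coordinate in a fixed set, a varying \<open>F\<close> a dependence on the other
  coordinates.\<close>

lemma card_dependent_coordinate:
  fixes V :: "'v set" and I :: "'i set"
  assumes "finite V" "finite I" "j \<in> I" and F: "\<And>z. finite (F z) \<and> card (F z) \<le> s"
  shows "card {x \<in> PiE I (\<lambda>_. V). x j \<in> F (restrict x (I - {j}))} \<le> card V ^ (card I - 1) * s"
proof -
  define Z where "Z = PiE (I - {j}) (\<lambda>_. V)"
  have fZ: "finite Z" unfolding Z_def using assms by (intro finite_PiE) auto
  have "card {x \<in> PiE I (\<lambda>_. V). x j \<in> F (restrict x (I - {j}))} \<le> card (Sigma Z F)"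
  proof (rule card_inj_on_le[where f="\<lambda>x. (restrict x (I - {j}), x j)"])
    show "inj_on (\<lambda>x. (restrict x (I - {j}), x j)) {x \<in> PiE I (\<lambda>_. V). x j \<in> F (restrict x (I - {j}))}"
    proof (rule inj_onI)
      fix x y assume x: "x \<in> {x \<in> PiE I (\<lambda>_. V). x j \<in> F (restrict x (I - {j}))}"
        and y: "y \<in> {x \<in> PiE I (\<lambda>_. V). x j \<in> F (restrict x (I - {j}))}"
        and eq: "(restrict x (I - {j}), x j) = (restrict y (I - {j}), y j)"
      show "x = y"
      proof (rule PiE_ext)
        show "x \<in> PiE I (\<lambda>_. V)" "y \<in> PiE I (\<lambda>_. V)" using x y by auto
        show "x i = y i" if "i \<in> I" for i
        proof (cases "i = j")
          case False
          then have "i \<in> I - {j}" using that by auto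
          then show ?thesis using eq by (metis Pair_inject restrict_apply')
        qed (use eq in simp)
      qed
    qed
    show "finite (Sigma Z F)" using fZ F by auto
    have "restrict x (I - {j}) \<in> Z" if "x \<in> PiE I (\<lambda>_. V)" for x
      using that unfolding Z_def restrict_PiE_iff by auto
    then show "(\<lambda>x. (restrict x (I - {j}), x j)) ` {x \<in> PiE I (\<lambda>_. V). x j \<in> F (restrict x (I - {j}))}
      \<subseteq> Sigma Z F" by blast
  qed
  also have "\<dots> = (\<Sum>z\<in>Z. card (F z))" using fZ F by (simp add: card_SigmaI)
  also have "\<dots> \<le> (\<Sum>z\<in>Z. s)" using F by (intro sum_mono) auto
  also have "\<dots> = card V ^ (card I - 1) * s"
    unfolding Z_def using assms by (simp add: card_PiE)
  finally show ?thesis .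
qed

text \<open>Signatures are subsets of \<open>S\<close>, so there are at most
  \<open>2 ^ card S\<close> cells, and each cell counted here has fewer than \<open>t\<close>
  points.\<close>

lemma card_small_cells:
  fixes V :: "'v set"
  assumes "finite V" "finite S" "t \<ge> 0"
  shows "real (card {v \<in> V. real (card (cell V S v)) < t}) \<le> 2 ^ card S * t"
proof -
  define A where "A = {v \<in> V. real (card (cell V S v)) < t}"
  have fA: "finite A" unfolding A_def using assms by simp
  have "sig S ` A \<subseteq> Pow S" unfolding sig_def by auto
  then have c: "card (sig S ` A) \<le> 2 ^ card S"
    using card_mono[of "Pow S" "sig S ` A"] assms(2) by (simp add: card_Pow)
  have "real (card A) = (\<Sum>l\<in>sig S ` A. \<Sum>v | v \<in> A \<and> sig S v = l. 1)"
    using sum_fibres[OF fA, of "\<lambda>_. 1" "sig S"] by simp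
  also have "\<dots> \<le> (\<Sum>l\<in>sig S ` A. t)"
  proof (rule sum_mono)
    fix l assume "l \<in> sig S ` A"
    then obtain u where u: "u \<in> A" "l = sig S u" by auto
    have "card {v. v \<in> A \<and> sig S v = l} \<le> card (cell V S u)"
      using assms(1) u(2) by (intro card_mono) (auto simp: cell_def A_def)
    then show "(\<Sum>v | v \<in> A \<and> sig S v = l. 1) \<le> t"
      using u(1) unfolding A_def by simp
  qed
  also have "\<dots> \<le> 2 ^ card S * t"
  proof -
    have "real (card (sig S ` A)) \<le> 2 ^ card S" using c by (metis of_nat_le_iff of_nat_numeral of_nat_power)
    then show ?thesis using assms(3) by (simp add: mult_right_mono)
  qed
  finally show ?thesis unfolding A_def .
qed

text \<open>The condition on the average is constant on fibres, so on the selected fibres the points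
  with \<open>P\<close> can be counted by summing the averages, all of which are below
  \<open>d\<close>.\<close>

lemma card_sparse_fibres:
  fixes P :: "'x \<Rightarrow> bool"
  assumes "finite X" "d \<ge> 0"
  shows "real (card {x \<in> X. P x \<and> fibre_avg X g (\<lambda>x. of_bool (P x)) x < d}) \<le> d * real (card X)"
proof -
  let ?a = "fibre_avg X g (\<lambda>x. of_bool (P x))"
  have "real (card {x \<in> X. P x \<and> ?a x < d}) = (\<Sum>x\<in>X. of_bool (?a x < d) * of_bool (P x))"
    using assms(1) by (simp add: sum_of_bool_eq Int_def of_bool_conj[symmetric] conj_commute)
  also have "\<dots> = (\<Sum>x\<in>X. of_bool (?a x < d) * ?a x)"
  proof (rule sum_mult_fibre_avg[symmetric, OF assms(1)])
    fix x y assume "g x = g y"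
    then have "?a x = ?a y" by (rule fibre_avg_cong[of g x y])
    then show "of_bool (?a x < d) = (of_bool (?a y < d) :: real)" by (simp only:)
  qed
  also have "\<dots> \<le> (\<Sum>x\<in>X. d)" using assms(2) by (intro sum_mono) auto
  finally show ?thesis by (simp add: mult.commute)
qed

text \<open>The three reasons why the counting lemma cannot be applied around a hyperedge of
  \<open>L\<close> enumerated by \<open>y\<close>: its box of cells is irregular, has low density in
  \<open>L\<close>, or has a side too small for the box to be a positive proportion of all
  tuples.\<close>

definition bad_tuples ::
  "'v set \<Rightarrow> 'v set set \<Rightarrow> 'v set set \<Rightarrow> 'i set \<Rightarrow> real \<Rightarrow> real \<Rightarrow> real \<Rightarrow> ('i \<Rightarrow> 'v) set" where
  "bad_tuples V L S E \<epsilon> d t = {y \<in> PiE E (\<lambda>_. V). y ` E \<in> L \<and>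
     (y \<in> irregular V S E (\<lambda>y. of_bool (y ` E \<in> L)) \<epsilon> \<or>
      fibre_avg (PiE E (\<lambda>_. V)) (tuple_sig E S) (\<lambda>y. of_bool (y ` E \<in> L)) y < d \<or>
      (\<exists>i\<in>E. real (card (cell V S (y i))) < t))}"

lemma card_bad_tuples:
  fixes V :: "'v set" and E :: "'i set"
  assumes "finite V" "finite S" "finite E" "card E = r" "r > 0" "d \<ge> 0" "\<tau> \<ge> 0"
  shows "real (card (bad_tuples V L S E \<epsilon> d (\<tau> * real (card V))))
    \<le> real (card (irregular V S E (\<lambda>y. of_bool (y ` E \<in> L)) \<epsilon>))
      + (d + real r * 2 ^ card S * \<tau>) * real (card V) ^ r"
proof -
  define X where "X = PiE E (\<lambda>_. V)"
  have fX: "finite X" unfolding X_def using assms by (intro finite_PiE) auto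
  have cX: "card X = card V ^ r" unfolding X_def using assms by (simp add: card_PiE)
  define f :: "('i \<Rightarrow> 'v) \<Rightarrow> real" where "f = (\<lambda>y. of_bool (y ` E \<in> L))"
  define M1 where "M1 = irregular V S E f \<epsilon>"
  define M2 where "M2 = {y \<in> X. y ` E \<in> L \<and> fibre_avg X (tuple_sig E S) f y < d}"
  define A where "A = {v \<in> V. real (card (cell V S v)) < \<tau> * real (card V)}"
  define M3 where "M3 = (\<Union>i\<in>E. {y \<in> X. y i \<in> A})"
  have fin: "finite M1" "finite M2" "finite M3"
    using fX assms(3) unfolding M1_def M2_def M3_def irregular_def X_def by auto
  have "bad_tuples V L S E \<epsilon> d (\<tau> * real (card V)) \<subseteq> M1 \<union> M2 \<union> M3"
    unfolding bad_tuples_def M1_def M2_def M3_def A_def f_def X_def by auto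
  then have "card (bad_tuples V L S E \<epsilon> d (\<tau> * real (card V))) \<le> card (M1 \<union> M2 \<union> M3)"
    using fin by (intro card_mono) auto
  also have "\<dots> \<le> card M1 + card M2 + card M3"
    by (meson add_right_mono card_Un_le order_trans)
  finally have "real (card (bad_tuples V L S E \<epsilon> d (\<tau> * real (card V))))
    \<le> real (card M1) + real (card M2) + real (card M3)" by linarith
  moreover have "real (card M2) \<le> d * real (card V) ^ r"
    using card_sparse_fibres[OF fX assms(6), of "\<lambda>y. y ` E \<in> L" "tuple_sig E S"] cX
    unfolding M2_def f_def by simp
  moreover have "real (card M3) \<le> real r * 2 ^ card S * \<tau> * real (card V) ^ r"
  proof -
    have fA: "finite A" unfolding A_def using assms(1) by simp
    have "card M3 \<le> (\<Sum>i\<in>E. card {y \<in> X. y i \<in> A})"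
      unfolding M3_def by (rule card_UN_le[OF assms(3)])
    also have "\<dots> \<le> (\<Sum>i\<in>E. card V ^ (card E - 1) * card A)"
      unfolding X_def using card_dependent_coordinate[OF assms(1,3), of _ "\<lambda>_. A" "card A"] fA
      by (intro sum_mono) auto
    also have "\<dots> = r * (card V ^ (r - 1) * card A)" using assms(4) by simp
    finally have "real (card M3) \<le> real (r * (card V ^ (r - 1) * card A))"
      by (simp only: of_nat_le_iff)
    also have "\<dots> = real r * real (card V) ^ (r - 1) * real (card A)" by simp
    also have "\<dots> \<le> real r * real (card V) ^ (r - 1) * (2 ^ card S * (\<tau> * real (card V)))"
      unfolding A_def using assms by (intro mult_left_mono card_small_cells) auto
    also have "\<dots> = real r * 2 ^ card S * \<tau> * (real (card V) ^ (r - 1) * real (card V))" by simp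
    also have "real (card V) ^ (r - 1) * real (card V) = real (card V) ^ r"
      using assms(5) by (metis Suc_diff_1 power_Suc2)
    finally show ?thesis .
  qed
  ultimately show ?thesis unfolding M1_def f_def by (simp add: algebra_simps)
qed

text \<open>\<open>M\<close> consists of the images of all bad tuples. A single map \<open>w\<close>
  that avoids \<open>M\<close> sends each \<open>E b\<close> into a regular and dense box with large
  cells; the counting lemma, applied in the cells around \<open>w\<close>, then yields a positive
  proportion of all maps.\<close>

theorem linear_hypergraph_removal:
  fixes I :: "'i set" and B :: "'b set" and E :: "'b \<Rightarrow> 'i set"
  assumes "finite I" "finite B" and E: "\<And>b. b \<in> B \<Longrightarrow> E b \<subseteq> I \<and> card (E b) = r" and "r > 0"
    and lin: "\<And>b b'. b \<in> B \<Longrightarrow> b' \<in> B \<Longrightarrow> b \<noteq> b' \<Longrightarrow> card (E b \<inter> E b') \<le> 1"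
    and "\<eta> > 0"
  shows "\<exists>\<kappa> > 0. \<forall>(V :: 'v set) L. finite V \<longrightarrow>
    (\<exists>M. M \<subseteq> L \<and> real (card M) \<le> \<eta> * real (card V) ^ r \<and>
      (\<forall>w. w ` I \<subseteq> V \<and> (\<forall>b\<in>B. w ` E b \<in> L - M) \<longrightarrow>
        \<kappa> * real (card V) ^ card I \<le> real (card {x \<in> PiE I (\<lambda>_. V). \<forall>b\<in>B. x ` E b \<in> L})))"
proof -
  define p where "p = card B"
  \<comment> \<open>A third of \<eta> each is allotted to irregular tuples, sparse boxes and small
    cells; \<open>d\<close> settles the second, summed over the \<open>p\<close> edges. The
    \<open>+ 1\<close> keeps the denominators positive when \<open>B\<close> is empty.\<close>
  define d where "d = min 1 (\<eta> / (3 * (real p + 1)))"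
  have d: "0 < d" "d \<le> 1" "d \<le> \<eta> / (3 * (real p + 1))" unfolding d_def using \<open>\<eta> > 0\<close> by auto
  \<comment> \<open>The errors \<open>real p * \<epsilon>\<close> of the counting lemma then use up
    at most half of the main term \<open>d ^ p\<close>.\<close>
  define \<epsilon> where "\<epsilon> = d ^ p / (2 * (real p + 1))"
  have \<epsilon>: "\<epsilon> > 0" unfolding \<epsilon>_def using d by simp
  have finE: "finite (E b)" if "b \<in> B" for b
    using E[OF that] assms(1) finite_subset by blast
  obtain K where K: "\<And>(V :: 'v set) (f :: 'b \<Rightarrow> ('i \<Rightarrow> 'v) \<Rightarrow> real).
    finite V \<Longrightarrow> (\<And>b x. b \<in> B \<Longrightarrow> 0 \<le> f b x \<and> f b x \<le> 1) \<Longrightarrow>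
    \<exists>S. finite S \<and> card S \<le> K \<and>
      (\<Sum>b\<in>B. real (card (irregular V S (E b) (f b) \<epsilon>))) \<le> (\<eta> / 3) * real (card V) ^ r"
  proof (rule hypergraph_regularity[where B=B and E=E and r=r and \<epsilon>=\<epsilon> and \<eta>="\<eta> / 3" and ?'v='v])
    show "finite (E b) \<and> card (E b) = r" if "b \<in> B" for b using finE E that by blast
  qed (rule assms(2) \<epsilon> assms(4) divide_pos_pos[OF assms(6)] zero_less_numeral | erule that)+
  \<comment> \<open>\<open>\<tau>\<close> may depend on \<open>K\<close>, since the regularity lemma
    does not involve it; tuples with a coordinate in a small cell stay within the last third of
    \<eta>.\<close>
  define \<tau> where "\<tau> = min 1 (\<eta> / (3 * (real p + 1) * (real r * 2 ^ K)))"
  have \<tau>: "0 < \<tau>" "\<tau> \<le> 1" "\<tau> \<le> \<eta> / (3 * (real p + 1) * (real r * 2 ^ K))"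
    unfolding \<tau>_def using \<open>\<eta> > 0\<close> \<open>r > 0\<close> by auto
  show ?thesis
  proof (intro exI[of _ "d ^ p / 2 * \<tau> ^ card I"] conjI allI impI)
    show "d ^ p / 2 * \<tau> ^ card I > 0" using d \<tau> by simp
    fix V :: "'v set" and L :: "'v set set"
    assume V: "finite V"
    define f :: "'b \<Rightarrow> ('i \<Rightarrow> 'v) \<Rightarrow> real" where "f b = (\<lambda>y. of_bool (y ` E b \<in> L))" for b
    obtain S where S: "finite S" "card S \<le> K"
      "(\<Sum>b\<in>B. real (card (irregular V S (E b) (f b) \<epsilon>))) \<le> (\<eta> / 3) * real (card V) ^ r"
      using K[OF V, of f] unfolding f_def by auto
    define bad where "bad b = bad_tuples V L S (E b) \<epsilon> d (\<tau> * real (card V))" for b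
    have fin_bad: "finite (bad b)" if "b \<in> B" for b
    proof -
      have "bad b \<subseteq> PiE (E b) (\<lambda>_. V)" unfolding bad_def bad_tuples_def by blast
      moreover have "finite (PiE (E b) (\<lambda>_. V))" using finE[OF that] V by (intro finite_PiE) auto
      ultimately show ?thesis using finite_subset by blast
    qed
    define M where "M = (\<Union>b\<in>B. (\<lambda>y. y ` E b) ` bad b)"
    have "M \<subseteq> L" unfolding M_def bad_def bad_tuples_def by auto
    moreover have "real (card M) \<le> \<eta> * real (card V) ^ r"
    proof -
      have "card M \<le> (\<Sum>b\<in>B. card ((\<lambda>y. y ` E b) ` bad b))"
        unfolding M_def by (rule card_UN_le[OF assms(2)])
      also have "\<dots> \<le> (\<Sum>b\<in>B. card (bad b))" by (intro sum_mono card_image_le fin_bad)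
      finally have "real (card M) \<le> (\<Sum>b\<in>B. real (card (bad b)))"
        by (metis of_nat_le_iff of_nat_sum)
      also have "\<dots> \<le> (\<Sum>b\<in>B. real (card (irregular V S (E b) (f b) \<epsilon>))
          + (d + real r * 2 ^ card S * \<tau>) * real (card V) ^ r)"
        unfolding bad_def f_def using V S(1) finE E \<open>r > 0\<close> d \<tau>
        by (intro sum_mono card_bad_tuples) auto
      also have "\<dots> \<le> (\<eta> / 3) * real (card V) ^ r
          + real p * (d + real r * 2 ^ card S * \<tau>) * real (card V) ^ r"
        using S(3) by (simp add: sum.distrib p_def)
      also have "\<dots> = (\<eta> / 3 + real p * d + real p * (real r * 2 ^ card S * \<tau>)) * real (card V) ^ r"
        by (simp add: algebra_simps)
      also have "\<dots> \<le> (\<eta> / 3 + \<eta> / 3 + \<eta> / 3) * real (card V) ^ r"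
      proof (intro mult_right_mono add_mono order_refl)
        have eq: "(real p + 1) * (\<eta> / (3 * (real p + 1))) = \<eta> / 3" by (simp add: field_simps)
        have "real p * d \<le> (real p + 1) * (\<eta> / (3 * (real p + 1)))"
          using d by (intro mult_mono) auto
        then show "real p * d \<le> \<eta> / 3" unfolding eq .
        have "X * (\<eta> / (Y * X)) = \<eta> / Y" if "X \<noteq> 0" for X Y :: real
          using that by simp
        then have cancel: "real r * 2 ^ K * (\<eta> / (3 * (real p + 1) * (real r * 2 ^ K))) = \<eta> / (3 * (real p + 1))"
          using \<open>r > 0\<close> by (metis mult_eq_0_iff of_nat_0_eq_iff power_not_zero not_gr0 zero_neq_numeral)
        have "real r * 2 ^ card S * \<tau> \<le> real r * 2 ^ K * (\<eta> / (3 * (real p + 1) * (real r * 2 ^ K)))"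
          using \<tau> S(2) by (intro mult_mono power_increasing) auto
        also note cancel
        finally have "real p * (real r * 2 ^ card S * \<tau>) \<le> (real p + 1) * (\<eta> / (3 * (real p + 1)))"
          using \<open>\<eta> > 0\<close> \<tau>(1) by (intro mult_mono) auto
        then show "real p * (real r * 2 ^ card S * \<tau>) \<le> \<eta> / 3" unfolding eq .
      qed simp
      finally show ?thesis by simp
    qed
    moreover have "d ^ p / 2 * \<tau> ^ card I * real (card V) ^ card I
        \<le> real (card {x \<in> PiE I (\<lambda>_. V). \<forall>b\<in>B. x ` E b \<in> L})"
      if w: "w ` I \<subseteq> V" "\<forall>b\<in>B. w ` E b \<in> L - M" for w
    proof -
      \<comment> \<open>A coordinate in no hyperedge is unconstrained and runs through all of
        \<open>V\<close>, because nothing bounds the cell of its image from below.\<close>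
      define C where "C i = (if i \<in> (\<Union>b\<in>B. E b) then cell V S (w i) else V)" for i
      have CV: "C i \<subseteq> V" for i unfolding C_def cell_def by auto
      have finC: "finite (C i)" for i using CV V finite_subset by blast
      define y where "y b = restrict w (E b)" for b
      have yim: "y b ` E b = w ` E b" for b unfolding y_def by auto
      have y: "y b \<in> PiE (E b) (\<lambda>_. V)" if "b \<in> B" for b
        using w(1) E[OF that] unfolding y_def by auto
      have not_bad: "y b \<notin> bad b" if "b \<in> B" for b
      proof
        assume "y b \<in> bad b"
        then have "y b ` E b \<in> M" unfolding M_def using that by blast
        then show False using w(2) that unfolding yim by blast
      qed
      have "y b ` E b \<in> L" if "b \<in> B" for b using w(2) that unfolding yim by blast
      then have good: "y b \<notin> irregular V S (E b) (f b) \<epsilon>"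
        "fibre_avg (PiE (E b) (\<lambda>_. V)) (tuple_sig (E b) S) (f b) (y b) \<ge> d"
        "\<And>i. i \<in> E b \<Longrightarrow> real (card (cell V S (y b i))) \<ge> \<tau> * real (card V)" if "b \<in> B" for b
        using not_bad[OF that] y[OF that] that unfolding bad_def bad_tuples_def f_def by force+
      have cell_C: "cell V S (y b i) = C i" if "b \<in> B" "i \<in> E b" for b i
        using that unfolding C_def y_def by auto
      have cell_Pi: "PiE (E b) (\<lambda>i. cell V S (y b i)) = PiE (E b) C" if "b \<in> B" for b
        by (rule PiE_cong) (rule cell_C[OF that])
      have "(d ^ p - real p * \<epsilon>) * real (card (PiE I C))
        \<le> real (card {x \<in> PiE I C. \<forall>b\<in>B. restrict x (E b) ` E b \<in> L})"
        unfolding p_def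
      proof (rule linear_counting[OF assms(1,2),
            where \<delta>="\<lambda>b. fibre_avg (PiE (E b) (\<lambda>_. V)) (tuple_sig (E b) S) (f b) (y b)"])
        fix b U assume b: "b \<in> B" and U: "\<And>i. i \<in> E b \<Longrightarrow> U i \<subseteq> C i"
        then have "\<forall>i\<in>E b. U i \<subseteq> cell V S (y b i)" using cell_C by blast
        then have "\<bar>\<Sum>z\<in>PiE (E b) U. f b z - fibre_avg (PiE (E b) (\<lambda>_. V)) (tuple_sig (E b) S) (f b) (y b)\<bar>
          < \<epsilon> * real (card (PiE (E b) (\<lambda>i. cell V S (y b i))))"
          using good(1)[OF b] y[OF b] unfolding irregular_def mem_Collect_eq not_le[symmetric] by blast
        then show "\<bar>\<Sum>z\<in>PiE (E b) U. of_bool (z ` E b \<in> L)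
            - fibre_avg (PiE (E b) (\<lambda>_. V)) (tuple_sig (E b) S) (f b) (y b)\<bar>
          \<le> \<epsilon> * real (card (PiE (E b) C))"
          unfolding cell_Pi[OF b] f_def by simp
      qed (use E lin finC d \<epsilon> good(2) in auto)
      moreover have "d ^ p / 2 \<le> d ^ p - real p * \<epsilon>"
      proof -
        have "real p * \<epsilon> \<le> (real p + 1) * \<epsilon>" using \<epsilon> by simp
        also have "\<dots> = d ^ p / 2" unfolding \<epsilon>_def by (simp add: field_simps)
        finally show ?thesis by linarith
      qed
      then have "d ^ p / 2 * real (card (PiE I C)) \<le> (d ^ p - real p * \<epsilon>) * real (card (PiE I C))"
        by (rule mult_right_mono) simp
      moreover have "\<tau> ^ card I * real (card V) ^ card I \<le> real (card (PiE I C))"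
      proof -
        have "\<tau> * real (card V) \<le> real (card (C i))" for i
        proof (cases "i \<in> (\<Union>b\<in>B. E b)")
          case True
          then obtain b where "b \<in> B" "i \<in> E b" by blast
          then show ?thesis using good(3) cell_C by metis
        next
          case False
          then show ?thesis using \<tau>(1,2) mult_right_mono[of \<tau> 1 "real (card V)"] unfolding C_def by simp
        qed
        then have "(\<Prod>i\<in>I. \<tau> * real (card V)) \<le> (\<Prod>i\<in>I. real (card (C i)))"
          using \<tau> by (intro prod_mono) auto
        then show ?thesis using assms(1) by (simp add: card_PiE power_mult_distrib)
      qed
      then have "d ^ p / 2 * (\<tau> ^ card I * real (card V) ^ card I) \<le> d ^ p / 2 * real (card (PiE I C))"
        using d by (intro mult_left_mono) auto
      moreover have "card {x \<in> PiE I C. \<forall>b\<in>B. restrict x (E b) ` E b \<in> L}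
          \<le> card {x \<in> PiE I (\<lambda>_. V). \<forall>b\<in>B. x ` E b \<in> L}"
      proof (rule card_mono)
        show "finite {x \<in> PiE I (\<lambda>_. V). \<forall>b\<in>B. x ` E b \<in> L}"
          using assms(1) V by (intro finite_subset[OF _ finite_PiE[of I "\<lambda>_. V"]]) auto
        have "PiE I C \<subseteq> PiE I (\<lambda>_. V)" using CV by (intro PiE_mono) auto
        then show "{x \<in> PiE I C. \<forall>b\<in>B. restrict x (E b) ` E b \<in> L} \<subseteq> {x \<in> PiE I (\<lambda>_. V). \<forall>b\<in>B. x ` E b \<in> L}"
          by auto
      qed
      ultimately show ?thesis by (simp add: mult.assoc)
    qed
    ultimately show "\<exists>M. M \<subseteq> L \<and> real (card M) \<le> \<eta> * real (card V) ^ r \<and>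
      (\<forall>w. w ` I \<subseteq> V \<and> (\<forall>b\<in>B. w ` E b \<in> L - M) \<longrightarrow>
        d ^ p / 2 * \<tau> ^ card I * real (card V) ^ card I
          \<le> real (card {x \<in> PiE I (\<lambda>_. V). \<forall>b\<in>B. x ` E b \<in> L}))"
      by blast
  qed
qed

section \<open>Pieces of neighbourhoods\<close>

lemma ramsey_two_colours:
  "\<exists>R\<ge>r. \<forall>(W :: 'v set) P. finite W \<longrightarrow> card W = R \<longrightarrow>
    (\<exists>Z \<subseteq> W. card Z = k \<and> ((\<forall>e\<in>nsets Z r. P e) \<or> (\<forall>e\<in>nsets Z r. \<not> P e)))"
proof -
  obtain R0 :: nat where R0: "partn_lst {..<R0} [k, k] r" using ramsey_full by blast
  \<comment> \<open>Enlarging \<open>R0\<close> preserves the partition property, and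
    \<open>r \<le> R\<close> later makes \<open>R choose r\<close> positive.\<close>
  define R where "R = max R0 r"
  have R: "partn_lst {..<R} [k, k] r"
    by (rule partn_lst_greater_resource[OF R0]) (simp add: R_def)
  show ?thesis
  proof (intro exI[of _ R] conjI allI impI)
    show "r \<le> R" unfolding R_def by simp
    fix W :: "'v set" and P assume W: "finite W" "card W = R"
    obtain h where h: "bij_betw h {..<R} W"
      using W by (metis bij_betw_iff_card card_lessThan finite_lessThan)
    define f where "f e = (if P (h ` e) then 0 else 1 :: nat)" for e
    have "f \<in> nsets {..<R} r \<rightarrow> {..<2}" unfolding f_def by auto
    then obtain i Y where i: "i < 2" and Y: "Y \<in> nsets {..<R} k" "f ` nsets Y r \<subseteq> {i}"
      using R unfolding partn_lst_def monochromatic_def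
      by (fastforce simp: less_2_cases_iff numeral_2_eq_2 less_Suc_eq)
    have Y': "Y \<subseteq> {..<R}" "card Y = k" using Y(1) by (auto simp: nsets_def)
    have inj: "inj_on h Y" using h Y'(1) by (meson bij_betw_def inj_on_subset)
    have "P e \<longleftrightarrow> i = 0" if "e \<in> nsets (h ` Y) r" for e
    proof -
      obtain e0 where e0: "e0 \<in> nsets Y r" "e = h ` e0"
        using nset_image_obtains[OF \<open>e \<in> nsets (h ` Y) r\<close> inj] by blast
      then have "f e0 = i" using Y(2) by blast
      then show ?thesis using e0(2) unfolding f_def by (auto split: if_splits)
    qed
    moreover have "h ` Y \<subseteq> W" using h Y'(1) unfolding bij_betw_def by blast
    moreover have "card (h ` Y) = k" using card_image[OF inj] Y'(2) by simp
    ultimately show "\<exists>Z \<subseteq> W. card Z = k \<and> ((\<forall>e\<in>nsets Z r. P e) \<or> (\<forall>e\<in>nsets Z r. \<not> P e))"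
      by (intro exI[of _ "h ` Y"]) auto
  qed
qed

lemma card_supersets:
  assumes "finite Q" "e \<subseteq> Q" "card e \<le> R"
  shows "card {W \<in> nsets Q R. e \<subseteq> W} = (card Q - card e) choose (R - card e)"
proof -
  have fe: "finite e" using assms finite_subset by blast
  have "bij_betw (\<lambda>W. W - e) {W \<in> nsets Q R. e \<subseteq> W} (nsets (Q - e) (R - card e))"
  proof (rule bij_betw_byWitness[where f'="\<lambda>U. U \<union> e"])
    show "(\<lambda>W. W - e) ` {W \<in> nsets Q R. e \<subseteq> W} \<subseteq> nsets (Q - e) (R - card e)"
      using fe by (auto simp: nsets_def card_Diff_subset)
    show "(\<lambda>U. U \<union> e) ` nsets (Q - e) (R - card e) \<subseteq> {W \<in> nsets Q R. e \<subseteq> W}"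
    proof
      fix W assume "W \<in> (\<lambda>U. U \<union> e) ` nsets (Q - e) (R - card e)"
      then obtain U where U: "W = U \<union> e" "U \<subseteq> Q - e" "finite U" "card U = R - card e"
        by (auto simp: nsets_def)
      have "card W = card U + card e" unfolding U(1) using U fe by (intro card_Un_disjoint) auto
      then show "W \<in> {W \<in> nsets Q R. e \<subseteq> W}" using U fe assms by (auto simp: nsets_def)
    qed
  qed (auto simp: nsets_def)
  then have "card {W \<in> nsets Q R. e \<subseteq> W} = card (nsets (Q - e) (R - card e))"
    by (rule bij_betw_same_card)
  then show ?thesis using assms fe by (simp add: card_Diff_subset)
qed

text \<open>With \<open>s = card Q\<close>, each member of \<open>M\<close> spoils
  \<open>(s - r) choose (R - r)\<close> of the \<open>R\<close>-subsets of \<open>Q\<close>. Double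
  counting pairs of an \<open>R\<close>-subset and an \<open>r\<close>-subset of it shows that,
  under \<open>few\<close>, the union bound leaves some \<open>R\<close>-subset unspoilt.\<close>

lemma avoid_few_subsets:
  assumes "finite Q" "r \<le> R" "R \<le> card Q" "M \<subseteq> nsets Q r"
    and few: "card M * (R choose r) < card Q choose r"
  obtains W where "W \<subseteq> Q" "card W = R" "nsets W r \<inter> M = {}"
proof -
  define s where "s = card Q"
  have fM: "finite M" using assms(1,4) finite_imp_finite_nsets finite_subset by blast
  have "card (\<Union>e\<in>M. {W \<in> nsets Q R. e \<subseteq> W}) \<le> (\<Sum>e\<in>M. card {W \<in> nsets Q R. e \<subseteq> W})"
    by (rule card_UN_le[OF fM])
  also have "\<dots> = (\<Sum>e\<in>M. (s - r) choose (R - r))"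
  proof (rule sum.cong[OF refl])
    fix e assume "e \<in> M"
    then have e: "e \<subseteq> Q" "card e = r" using assms(4) by (auto simp: nsets_def)
    show "card {W \<in> nsets Q R. e \<subseteq> W} = (s - r) choose (R - r)"
      using card_supersets[OF assms(1) e(1), of R] e(2) assms(2) unfolding s_def by simp
  qed
  also have "\<dots> = card M * ((s - r) choose (R - r))" by simp
  also have "\<dots> < s choose R"
  proof -
    have pos: "(s - r) choose (R - r) > 0" using assms(2,3) unfolding s_def by (simp add: diff_le_mono)
    have "(card M * ((s - r) choose (R - r))) * (R choose r) = (card M * (R choose r)) * ((s - r) choose (R - r))"
      by simp
    also have "\<dots> < (s choose r) * ((s - r) choose (R - r))"
      using few pos unfolding s_def by simp
    also have "\<dots> = (s choose R) * (R choose r)"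
      using choose_mult[OF assms(2), of s] assms(3) unfolding s_def by simp
    finally show ?thesis by simp
  qed
  also have "\<dots> = card (nsets Q R)" unfolding s_def by simp
  finally have lt: "card (\<Union>e\<in>M. {W \<in> nsets Q R. e \<subseteq> W}) < card (nsets Q R)" .
  have "\<not> nsets Q R \<subseteq> (\<Union>e\<in>M. {W \<in> nsets Q R. e \<subseteq> W})"
  proof
    assume "nsets Q R \<subseteq> (\<Union>e\<in>M. {W \<in> nsets Q R. e \<subseteq> W})"
    then have "nsets Q R = (\<Union>e\<in>M. {W \<in> nsets Q R. e \<subseteq> W})" by blast
    then show False using lt by simp
  qed
  then obtain W where W: "W \<in> nsets Q R" "\<And>e. e \<in> M \<Longrightarrow> \<not> e \<subseteq> W" by blast
  then show thesis using that[of W] by (auto simp: nsets_def)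
qed

text \<open>Greedy choice: at each stage at most \<open>card X\<close> forbidden and fewer than
  \<open>card B\<close> already chosen elements are excluded.\<close>

lemma distinct_representatives_avoiding:
  assumes "finite B" "finite X" "\<And>b. b \<in> B \<Longrightarrow> finite (D b) \<and> card X + card B \<le> card (D b)"
  shows "\<exists>v. inj_on v B \<and> (\<forall>b\<in>B. v b \<in> D b - X)"
  using assms(1,3)
proof (induction B rule: finite_induct)
  case (insert b B)
  have "\<exists>v. inj_on v B \<and> (\<forall>b\<in>B. v b \<in> D b - X)"
  proof (rule insert.IH)
    fix c assume "c \<in> B"
    then show "finite (D c) \<and> card X + card B \<le> card (D c)"
      using insert.prems[of c] insert.hyps by simp
  qed
  then obtain v where v: "inj_on v B" "\<forall>b\<in>B. v b \<in> D b - X" by blast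
  have "card (X \<union> v ` B) \<le> card X + card B"
    by (meson add_left_mono card_Un_le card_image_le insert.hyps(1) order_trans)
  also have "\<dots> < card (D b)" using insert.prems[of b] insert.hyps by simp
  finally have "\<not> D b \<subseteq> X \<union> v ` B"
    using card_mono[of "X \<union> v ` B" "D b"] assms(2) insert.hyps(1) by auto
  then obtain u where u: "u \<in> D b" "u \<notin> X" "u \<notin> v ` B" by blast
  have "inj_on (v(b := u)) (insert b B)"
    using v(1) u(3) insert.hyps(2) by (auto simp: inj_on_def)
  moreover have "\<forall>c\<in>insert b B. (v(b := u)) c \<in> D c - X"
    using v(2) u by auto
  ultimately show ?case by blast
qed simp

text \<open>A piece \<open>(v, Q)\<close> is an \<open>s\<close>-subset \<open>Q\<close> of the neighbourhood of its owner \<open>v\<close>. Cutting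
  the neighbourhoods into disjoint pieces replaces a bound on the maximum degree.\<close>

locale pieces =
  fixes V :: "'v set" and nbr :: "'v \<Rightarrow> 'v set" and \<P> :: "('v \<times> 'v set) set" and s :: nat
  assumes finV: "finite V"
    and piece: "(v, Q) \<in> \<P> \<Longrightarrow> v \<in> V \<and> Q \<subseteq> nbr v \<and> Q \<subseteq> V \<and> card Q = s"
    and no_loop: "v \<notin> nbr v"
    and disjoint: "(v, Q) \<in> \<P> \<Longrightarrow> (v, Q') \<in> \<P> \<Longrightarrow> Q \<inter> Q' \<noteq> {} \<Longrightarrow> Q = Q'"
    and many: "card V \<le> card \<P>"
begin

definition owners :: "'v set \<Rightarrow> 'v set" where
  "owners e = {v. \<exists>Q. (v, Q) \<in> \<P> \<and> e \<subseteq> Q}"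

text \<open>A nonempty \<open>owners e\<close> places \<open>e\<close> inside some piece, so that an
  owner can be assigned to it. The bound \<open>m\<close> limits the incidences between pieces and
  removed sets.\<close>

definition light :: "nat \<Rightarrow> nat \<Rightarrow> 'v set set" where
  "light r m = {e \<in> nsets V r. owners e \<noteq> {} \<and> card (owners e) < m}"

lemma finP: "finite \<P>"
proof (rule finite_subset)
  show "\<P> \<subseteq> V \<times> Pow V"
  proof (rule subrelI)
    fix v Q assume "(v, Q) \<in> \<P>"
    then show "(v, Q) \<in> V \<times> Pow V" using piece[of v Q] by blast
  qed
  show "finite (V \<times> Pow V)" using finV by simp
qed

lemma owners_subset: "owners e \<subseteq> V"
  unfolding owners_def using piece by blast

text \<open>Each owner contributes at most one piece, because its pieces are disjoint and
  \<open>e\<close> is nonempty.\<close>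

lemma card_pieces_containing:
  assumes "e \<noteq> {}"
  shows "card {p \<in> \<P>. e \<subseteq> snd p} \<le> card (owners e)"
proof (rule card_inj_on_le[of fst])
  show "inj_on fst {p \<in> \<P>. e \<subseteq> snd p}"
  proof (rule inj_onI)
    fix p q assume p: "p \<in> {p \<in> \<P>. e \<subseteq> snd p}" and q: "q \<in> {p \<in> \<P>. e \<subseteq> snd p}" and "fst p = fst q"
    then have "snd p \<inter> snd q \<noteq> {}" using assms by blast
    moreover have "(fst p, snd p) \<in> \<P>" "(fst p, snd q) \<in> \<P>"
      using p q prod.collapse[of p] prod.collapse[of q] \<open>fst p = fst q\<close> by auto
    ultimately have "snd p = snd q" using disjoint by blast
    then show "p = q" using \<open>fst p = fst q\<close> by (simp add: prod_eq_iff)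
  qed
  show "fst ` {p \<in> \<P>. e \<subseteq> snd p} \<subseteq> owners e" unfolding owners_def by force
  show "finite (owners e)" using owners_subset finV finite_subset by blast
qed

text \<open>Averaging over at least \<open>card V\<close> pieces: a light set lies in at most
  \<open>m\<close> of them, so there are at most \<open>m * card M\<close> incidences in
  all.\<close>

lemma piece_with_few:
  assumes "V \<noteq> {}" "M \<subseteq> light r m" "r > 0"
  obtains v Q where "(v, Q) \<in> \<P>" "card {e \<in> M. e \<subseteq> Q} * card V \<le> m * card M"
proof -
  have "finite (light r m)" unfolding light_def using finV finite_imp_finite_nsets[of V r] by simp
  then have fM: "finite M" using assms(2) finite_subset by blast
  have Vpos: "card V > 0" using assms(1) finV by (simp add: card_gt_0_iff)
  have "(\<Sum>p\<in>\<P>. card {e \<in> M. e \<subseteq> snd p}) = (\<Sum>e\<in>M. card {p \<in> \<P>. e \<subseteq> snd p})"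
    using sum.swap_restrict[OF finP fM, of "\<lambda>_ _. 1 :: nat" "\<lambda>p e. e \<subseteq> snd p"] by simp
  also have "\<dots> \<le> (\<Sum>e\<in>M. m)"
  proof (rule sum_mono)
    fix e assume "e \<in> M"
    then have "e \<in> light r m" using assms(2) by blast
    then have "e \<noteq> {}" "card (owners e) < m" using assms(3) unfolding light_def nsets_def by auto
    then show "card {p \<in> \<P>. e \<subseteq> snd p} \<le> m" using card_pieces_containing[of e] by linarith
  qed
  finally have total: "(\<Sum>p\<in>\<P>. card {e \<in> M. e \<subseteq> snd p}) \<le> m * card M" by (simp add: mult.commute)
  have "\<exists>p\<in>\<P>. card {e \<in> M. e \<subseteq> snd p} * card V \<le> m * card M"
  proof (rule ccontr)
    assume "\<not> ?thesis"
    then have "(\<Sum>p\<in>\<P>. m * card M) < (\<Sum>p\<in>\<P>. card {e \<in> M. e \<subseteq> snd p} * card V)"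
      using finP many Vpos by (intro sum_strict_mono) (auto simp: not_le)
    also have "\<dots> = (\<Sum>p\<in>\<P>. card {e \<in> M. e \<subseteq> snd p}) * card V" by (simp add: sum_distrib_right)
    also have "\<dots> \<le> (m * card M) * card V" using total by simp
    also have "\<dots> \<le> (m * card M) * card \<P>" using many by simp
    finally show False by (simp add: mult_ac)
  qed
  then show thesis using that by (metis prod.collapse)
qed

text \<open>The owner assigned to an edge is a function of the edge. Hence a coincidence among the images
  and the owners leaves at most \<open>s\<close> choices for one coordinate once the others are known. If two edges
  have the same owner, any vertex of the second edge singles out a piece of that owner, and this piece
  contains the rest of the second edge.\<close>

lemma card_degenerate_homs:
  fixes I :: "'i set" and B :: "'b set" and E :: "'b \<Rightarrow> 'i set"
  assumes "finite I" "finite B" "s > 0"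
    and E: "\<And>b. b \<in> B \<Longrightarrow> E b \<subseteq> I \<and> card (E b) = r" and "r \<ge> 2"
    and lin: "\<And>b b'. b \<in> B \<Longrightarrow> b' \<in> B \<Longrightarrow> b \<noteq> b' \<Longrightarrow> card (E b \<inter> E b') \<le> 1"
    and pc: "\<And>e. e \<in> L \<Longrightarrow> pc e \<in> \<P> \<and> e \<subseteq> snd (pc e)"
    and hom: "X = {x \<in> PiE I (\<lambda>_. V). \<forall>b\<in>B. x ` E b \<in> L}"
    and deg: "Y = {x \<in> X. \<not> (inj_on x I \<and> inj_on (\<lambda>b. fst (pc (x ` E b))) B \<and>
        (\<forall>b\<in>B. fst (pc (x ` E b)) \<notin> x ` I))}"
  shows "card Y \<le> (card I * card I + card B * card I + card B * card B) * (card V ^ (card I - 1) * s)"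
proof -
  let ?N = "card V ^ (card I - 1) * s"
  define o1 where "o1 e = fst (pc e)" for e
  define Y1 where "Y1 = (\<lambda>(i, j). {x \<in> PiE I (\<lambda>_. V). i \<noteq> j \<and> x i = x j})"
  define Y2 where "Y2 = (\<lambda>(b, i). {x \<in> X. o1 (x ` E b) = x i})"
  define Y3 where "Y3 = (\<lambda>(b, b'). {x \<in> X. b \<noteq> b' \<and> o1 (x ` E b) = o1 (x ` E b')})"
  have fPi: "finite (PiE I (\<lambda>_. V))" using assms(1) finV by (intro finite_PiE) auto
  have bound: "card T \<le> ?N" if "T \<subseteq> {x \<in> PiE I (\<lambda>_. V). R x}" "card {x \<in> PiE I (\<lambda>_. V). R x} \<le> ?N" for T R
  proof -
    have "finite {x \<in> PiE I (\<lambda>_. V). R x}" using fPi by simp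
    then show ?thesis using card_mono[OF _ that(1)] that(2) by linarith
  qed
  have c1: "card (Y1 q) \<le> ?N" if "q \<in> I \<times> I" for q
  proof -
    obtain i j where q: "q = (i, j)" "i \<in> I" "j \<in> I" using \<open>q \<in> I \<times> I\<close> by auto
    show ?thesis
    proof (cases "i = j")
      case False
      then have "Y1 q \<subseteq> {x \<in> PiE I (\<lambda>_. V). x i \<in> {restrict x (I - {i}) j}}"
        using q unfolding Y1_def by auto
      moreover have "card {x \<in> PiE I (\<lambda>_. V). x i \<in> {restrict x (I - {i}) j}} \<le> ?N"
        by (rule card_dependent_coordinate[where F="\<lambda>z. {z j}"]) (use assms finV q in auto)
      ultimately show ?thesis by (rule bound)
    qed (simp add: q Y1_def)
  qed
  have c2: "card (Y2 q) \<le> ?N" if "q \<in> B \<times> I" for q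
  proof -
    obtain b i where q: "q = (b, i)" "b \<in> B" "i \<in> I" using \<open>q \<in> B \<times> I\<close> by auto
    show ?thesis
    proof (cases "i \<in> E b")
      case True
      \<comment> \<open>The image of a vertex of \<open>E b\<close> is a neighbour of the owner of
        that edge, so equality would be a loop.\<close>
      have "o1 (x ` E b) \<noteq> x i" if "x \<in> X" for x
      proof -
        have "x ` E b \<in> L" using that q(2) unfolding hom by blast
        then have p: "pc (x ` E b) \<in> \<P>" "x ` E b \<subseteq> snd (pc (x ` E b))" using pc by auto
        then have "x i \<in> nbr (o1 (x ` E b))"
          using piece[of "fst (pc (x ` E b))" "snd (pc (x ` E b))"] True unfolding o1_def by auto
        then show ?thesis using no_loop by metis
      qed
      then have "Y2 q = {}" unfolding Y2_def q by auto
      then show ?thesis by simp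
    next
      case False
      have eq: "restrict x (I - {i}) ` E b = x ` E b" for x :: "'i \<Rightarrow> 'v"
        using False E[OF q(2)] by (intro image_cong) auto
      have "Y2 q \<subseteq> {x \<in> PiE I (\<lambda>_. V). x i \<in> {o1 (restrict x (I - {i}) ` E b)}}"
        unfolding eq Y2_def q hom by auto
      moreover have "card {x \<in> PiE I (\<lambda>_. V). x i \<in> {o1 (restrict x (I - {i}) ` E b)}} \<le> ?N"
        by (rule card_dependent_coordinate[where F="\<lambda>z. {o1 (z ` E b)}"]) (use assms finV q in auto)
      ultimately show ?thesis by (rule bound)
    qed
  qed
  have c3: "card (Y3 q) \<le> ?N" if "q \<in> B \<times> B" for q
  proof -
    obtain b b' where q: "q = (b, b')" "b \<in> B" "b' \<in> B" using \<open>q \<in> B \<times> B\<close> by auto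
    show ?thesis
    proof (cases "b = b'")
      case False
      have fE: "finite (E b')" "card (E b') \<ge> 2" "E b' \<subseteq> I"
        using E[OF q(3)] assms(1,5) finite_subset by auto
      have "\<not> E b' \<subseteq> E b"
      proof
        assume "E b' \<subseteq> E b"
        then have "E b \<inter> E b' = E b'" by blast
        then show False using lin[OF q(2,3) False] fE(2) by simp
      qed
      \<comment> \<open>\<open>j'\<close> is the coordinate with few choices: it lies outside
        \<open>E b\<close>, so the common owner is known without it. The second vertex
        \<open>j\<close> of \<open>E b'\<close> selects the piece of that owner.\<close>
      then obtain j' where j': "j' \<in> E b'" "j' \<notin> E b" by blast
      have "card (E b' - {j'}) \<ge> 1" using j'(1) fE by simp
      then have "E b' - {j'} \<noteq> {}" by (metis card.empty not_one_le_zero)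
      then obtain j where j: "j \<in> E b'" "j \<noteq> j'" by blast
      define F where "F z = \<Union>{Q. (o1 (z ` E b), Q) \<in> \<P> \<and> z j \<in> Q}" for z :: "'i \<Rightarrow> 'v"
      have F: "finite (F z) \<and> card (F z) \<le> s" for z
      proof (cases "\<exists>Q. (o1 (z ` E b), Q) \<in> \<P> \<and> z j \<in> Q")
        case True
        then obtain Q where Q: "(o1 (z ` E b), Q) \<in> \<P>" "z j \<in> Q" by blast
        then have "{Q. (o1 (z ` E b), Q) \<in> \<P> \<and> z j \<in> Q} = {Q}" using disjoint by blast
        then have "F z = Q" unfolding F_def by simp
        then show ?thesis using piece[OF Q(1)] finV finite_subset by auto
      next
        case False
        then have "F z = {}" unfolding F_def by blast
        then show ?thesis by simp
      qed
      have eq: "restrict x (I - {j'}) ` E b = x ` E b" for x :: "'i \<Rightarrow> 'v"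
        using j'(2) E[OF q(2)] by (intro image_cong) auto
      have "x j' \<in> F (restrict x (I - {j'}))" if "x \<in> Y3 q" for x
      proof -
        have x: "x \<in> X" "o1 (x ` E b) = o1 (x ` E b')" using that unfolding Y3_def q by auto
        have "x ` E b' \<in> L" using x(1) q(3) unfolding hom by blast
        then have p: "pc (x ` E b') \<in> \<P>" "x ` E b' \<subseteq> snd (pc (x ` E b'))" using pc by auto
        have "(o1 (x ` E b), snd (pc (x ` E b'))) \<in> \<P>" unfolding x(2) using p(1) by (simp add: o1_def)
        moreover have "restrict x (I - {j'}) j = x j" using j fE(3) by auto
        ultimately show ?thesis using p(2) j(1) j'(1) unfolding F_def eq by auto
      qed
      then have "Y3 q \<subseteq> {x \<in> PiE I (\<lambda>_. V). x j' \<in> F (restrict x (I - {j'}))}"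
        unfolding Y3_def q hom by blast
      moreover have "card {x \<in> PiE I (\<lambda>_. V). x j' \<in> F (restrict x (I - {j'}))} \<le> ?N"
        by (rule card_dependent_coordinate[OF finV assms(1) _ F]) (use j'(1) fE in auto)
      ultimately show ?thesis by (rule bound)
    qed (simp add: q Y3_def)
  qed
  have sub: "Y \<subseteq> (\<Union>q\<in>I \<times> I. Y1 q) \<union> (\<Union>q\<in>B \<times> I. Y2 q) \<union> (\<Union>q\<in>B \<times> B. Y3 q)"
  proof
    fix x assume "x \<in> Y"
    then have x: "x \<in> X" "\<not> inj_on x I \<or> \<not> inj_on (\<lambda>b. o1 (x ` E b)) B \<or> (\<exists>b\<in>B. o1 (x ` E b) \<in> x ` I)"
      unfolding deg o1_def by auto
    have xP: "x \<in> PiE I (\<lambda>_. V)" using x(1) unfolding hom by blast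
    from x(2) show "x \<in> (\<Union>q\<in>I \<times> I. Y1 q) \<union> (\<Union>q\<in>B \<times> I. Y2 q) \<union> (\<Union>q\<in>B \<times> B. Y3 q)"
    proof (elim disjE)
      assume "\<not> inj_on x I"
      then obtain i j where "i \<in> I" "j \<in> I" "i \<noteq> j" "x i = x j" unfolding inj_on_def by blast
      then have "x \<in> Y1 (i, j)" "(i, j) \<in> I \<times> I" using xP unfolding Y1_def by auto
      then show ?thesis by blast
    next
      assume "\<not> inj_on (\<lambda>b. o1 (x ` E b)) B"
      then obtain b b' where "b \<in> B" "b' \<in> B" "b \<noteq> b'" "o1 (x ` E b) = o1 (x ` E b')"
        unfolding inj_on_def by blast
      then have "x \<in> Y3 (b, b')" "(b, b') \<in> B \<times> B" using x(1) unfolding Y3_def by auto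
      then show ?thesis by blast
    next
      assume "\<exists>b\<in>B. o1 (x ` E b) \<in> x ` I"
      then obtain b i where "b \<in> B" "i \<in> I" "o1 (x ` E b) = x i" by blast
      then have "x \<in> Y2 (b, i)" "(b, i) \<in> B \<times> I" using x(1) unfolding Y2_def by auto
      then show ?thesis by blast
    qed
  qed
  have "finite ((\<Union>q\<in>I \<times> I. Y1 q) \<union> (\<Union>q\<in>B \<times> I. Y2 q) \<union> (\<Union>q\<in>B \<times> B. Y3 q))"
    by (rule finite_subset[OF _ fPi]) (auto simp: Y1_def Y2_def Y3_def hom)
  then have "card Y \<le> card ((\<Union>q\<in>I \<times> I. Y1 q) \<union> (\<Union>q\<in>B \<times> I. Y2 q) \<union> (\<Union>q\<in>B \<times> B. Y3 q))"
    using sub by (rule card_mono)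
  also have "\<dots> \<le> card (\<Union>q\<in>I \<times> I. Y1 q) + card (\<Union>q\<in>B \<times> I. Y2 q) + card (\<Union>q\<in>B \<times> B. Y3 q)"
    by (meson add_right_mono card_Un_le order_trans)
  also have "\<dots> \<le> card (I \<times> I) * ?N + card (B \<times> I) * ?N + card (B \<times> B) * ?N"
    using card_UN_le[of "I \<times> I" Y1] sum_mono[of "I \<times> I" "\<lambda>q. card (Y1 q)" "\<lambda>_. ?N"]
      card_UN_le[of "B \<times> I" Y2] sum_mono[of "B \<times> I" "\<lambda>q. card (Y2 q)" "\<lambda>_. ?N"]
      card_UN_le[of "B \<times> B" Y3] sum_mono[of "B \<times> B" "\<lambda>q. card (Y3 q)" "\<lambda>_. ?N"] c1 c2 c3 assms(1,2)
    by (intro add_mono) (auto intro: order_trans)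
  finally show ?thesis by (simp add: card_cartesian_product algebra_simps)
qed

end

text \<open>The sets on which removal is applied are the light ones. A piece with few removed sets contains a
  large set with none, and Ramsey's theorem makes a subset of it all heavy (the owners can be
  chosen greedily) or all light (removal then gives a positive density of homomorphisms).\<close>

theorem pieces_embed_linear_hypergraph:
  fixes I :: "'i set" and B :: "'b set" and E :: "'b \<Rightarrow> 'i set" and K :: real
  assumes "finite I" "finite B" and E: "\<And>b. b \<in> B \<Longrightarrow> E b \<subseteq> I \<and> card (E b) = r" and "r \<ge> 2"
    and lin: "\<And>b b'. b \<in> B \<Longrightarrow> b' \<in> B \<Longrightarrow> b \<noteq> b' \<Longrightarrow> card (E b \<inter> E b') \<le> 1"
    and "K > 0"
  shows "\<exists>R :: nat. \<exists>\<delta> > 0. \<forall>(V :: 'v set) nbr \<P> s.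
    pieces V nbr \<P> s \<and> R \<le> s \<and> real s \<le> \<delta> * real (card V) \<and> real (card V) ^ (r - 1) \<le> K * real s ^ r \<longrightarrow>
      (\<exists>x v. inj_on x I \<and> x ` I \<subseteq> V \<and> inj_on v B \<and> v ` B \<subseteq> V \<and> x ` I \<inter> v ` B = {} \<and>
         (\<forall>b\<in>B. x ` E b \<subseteq> nbr (v b)))"
proof -
  define k where "k = card I"
  \<comment> \<open>With \<open>m\<close> owners available, one can always avoid the images of
    \<open>I\<close> and the owners already chosen. \<open>T\<close> is the number of possible
    coincidences in \<open>card_degenerate_homs\<close>.\<close>
  define m where "m = k + card B"
  define T where "T = card I * card I + card B * card I + card B * card B"
  obtain R where R: "r \<le> R" and ramsey: "\<And>(W :: 'v set) P. finite W \<Longrightarrow> card W = R \<Longrightarrow>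
    \<exists>Z \<subseteq> W. card Z = k \<and> ((\<forall>e\<in>nsets Z r. P e) \<or> (\<forall>e\<in>nsets Z r. \<not> P e))"
    using ramsey_two_colours[where ?'v='v and r=r and k=k] by blast
  \<comment> \<open>\<open>c\<close> gathers the constants in passing from
    \<open>n ^ (r - 1)\<close> times \<open>R choose r\<close> to \<open>(s / r) ^ r\<close>, a
    lower bound for \<open>s choose r\<close>. The choice of \<eta> makes
    \<open>real m * \<eta> * c\<close> less than 1, so that \<open>avoid_few_subsets\<close> applies
    to the removed sets in one piece.\<close>
  define c where "c = K * real r ^ r * real (R choose r)"
  have c: "c > 0" unfolding c_def using \<open>K > 0\<close> \<open>r \<ge> 2\<close> R by (simp add: zero_less_binomial)
  define \<eta> where "\<eta> = 1 / (2 * (real m + 1) * c)"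
  have \<eta>: "\<eta> > 0" unfolding \<eta>_def using c by simp
  have "r > 0" using \<open>r \<ge> 2\<close> by simp
  obtain \<kappa> :: real where \<kappa>: "\<kappa> > 0" and removal: "\<And>(V :: 'v set) L. finite V \<Longrightarrow>
    \<exists>M. M \<subseteq> L \<and> real (card M) \<le> \<eta> * real (card V) ^ r \<and>
      (\<forall>w. w ` I \<subseteq> V \<and> (\<forall>b\<in>B. w ` E b \<in> L - M) \<longrightarrow>
        \<kappa> * real (card V) ^ card I \<le> real (card {x \<in> PiE I (\<lambda>_. V). \<forall>b\<in>B. x ` E b \<in> L}))"
    using linear_hypergraph_removal[where ?'v='v and I=I and B=B and E=E, OF assms(1,2) E \<open>r > 0\<close> lin \<eta>]
    by blast
  \<comment> \<open>Then \<open>real T * real s\<close> is less than \<kappa> times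
    \<open>card V\<close>, and the degenerate maps are outnumbered by the homomorphisms.\<close>
  define \<delta> where "\<delta> = \<kappa> / (2 * (real T + 1))"
  have \<delta>: "\<delta> > 0" unfolding \<delta>_def using \<kappa> by simp
  show ?thesis
  proof (intro exI[of _ R] exI[of _ \<delta>] conjI allI impI, rule \<delta>, elim conjE)
    fix V :: "'v set" and nbr \<P> s
    assume P: "pieces V nbr \<P> s" and s: "R \<le> s" "real s \<le> \<delta> * real (card V)"
      and N: "real (card V) ^ (r - 1) \<le> K * real s ^ r"
    interpret pieces V nbr \<P> s by (rule P)
    define n where "n = real (card V)"
    have spos: "s > 0" using s(1) R \<open>r > 0\<close> by linarith
    have "n \<noteq> 0"
    proof
      assume "n = 0"
      then have "real s \<le> 0" using s(2) unfolding n_def by simp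
      then show False using spos by simp
    qed
    then have npos: "n > 0" and Vne: "V \<noteq> {}" unfolding n_def by auto
    obtain M where M: "M \<subseteq> light r m" "real (card M) \<le> \<eta> * n ^ r"
      "\<forall>w. w ` I \<subseteq> V \<and> (\<forall>b\<in>B. w ` E b \<in> light r m - M) \<longrightarrow>
        \<kappa> * n ^ card I \<le> real (card {x \<in> PiE I (\<lambda>_. V). \<forall>b\<in>B. x ` E b \<in> light r m})"
      using removal[OF finV, of "light r m"] unfolding n_def by (elim exE conjE)
    obtain v0 Q where Q: "(v0, Q) \<in> \<P>" "card {e \<in> M. e \<subseteq> Q} * card V \<le> m * card M"
      by (rule piece_with_few[OF Vne M(1) \<open>r > 0\<close>])
    have QV: "Q \<subseteq> V" "card Q = s" using piece[OF Q(1)] by auto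
    have fQ: "finite Q" using QV finV finite_subset by blast
    define M' where "M' = {e \<in> M. e \<subseteq> Q}"
    have M'Q: "M' \<subseteq> nsets Q r" using M(1) unfolding M'_def light_def by (auto simp: nsets_def)
    \<comment> \<open>After division by \<open>n\<close>, the chosen piece contains at most order
      \<open>n ^ (r - 1)\<close> removed sets; by \<open>N\<close> this is of order
      \<open>s ^ r\<close>, like the number of its \<open>r\<close>-subsets.\<close>
    have "real (card M') * n \<le> real m * real (card M)"
      using Q(2) unfolding M'_def n_def by (metis of_nat_le_iff of_nat_mult)
    also have "\<dots> \<le> real m * (\<eta> * n ^ r)" using M(2) by (intro mult_left_mono) auto
    also have "\<dots> = (real m * \<eta> * n ^ (r - 1)) * n"
      using \<open>r > 0\<close> by (cases r) auto
    finally have "real (card M') \<le> real m * \<eta> * n ^ (r - 1)" using npos by simp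
    also have "\<dots> \<le> real m * \<eta> * (K * real s ^ r)"
      using N \<eta> unfolding n_def by (intro mult_left_mono) auto
    finally have "real (card M') * real (R choose r) \<le> real m * \<eta> * (K * real s ^ r) * real (R choose r)"
      by (rule mult_right_mono) simp
    also have "\<dots> = (real m * \<eta> * c) * (real s / real r) ^ r"
      unfolding c_def using \<open>r > 0\<close> by (simp add: power_divide)
    also have "\<dots> < 1 * (real s / real r) ^ r"
    proof (rule mult_strict_right_mono)
      have "real m * \<eta> * c = real m / (2 * (real m + 1))" unfolding \<eta>_def using c by simp
      then show "real m * \<eta> * c < 1" by (simp add: divide_less_eq)
      show "0 < (real s / real r) ^ r" using spos \<open>r > 0\<close> by simp
    qed
    also have "\<dots> \<le> real (s choose r)"
      using binomial_ge_n_over_k_pow_k[of r s, where ?'a=real] R s(1) by simp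
    finally have "real (card M' * (R choose r)) < real (s choose r)" by simp
    then have few: "card M' * (R choose r) < card Q choose r" unfolding QV(2) of_nat_less_iff .
    have RQ: "R \<le> card Q" using s(1) QV(2) by simp
    obtain W where W: "W \<subseteq> Q" "card W = R" "nsets W r \<inter> M' = {}"
      by (rule avoid_few_subsets[OF fQ R RQ M'Q few])
    have fW: "finite W" using W(1) fQ finite_subset by blast
    obtain Z where Z: "Z \<subseteq> W" "card Z = k" and
      mono: "(\<forall>e\<in>nsets Z r. card (owners e) < m) \<or> (\<forall>e\<in>nsets Z r. \<not> card (owners e) < m)"
      using ramsey[OF fW W(2), of "\<lambda>e. card (owners e) < m"] by blast
    have fZ: "finite Z" using Z(1) fW finite_subset by blast
    obtain w where w: "bij_betw w I Z"
      using Z(2) fZ assms(1) unfolding k_def by (metis bij_betw_iff_card)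
    have wI: "inj_on w I" "w ` I = Z" using w unfolding bij_betw_def by auto
    have ZV: "Z \<subseteq> V" using Z(1) W(1) QV(1) by blast
    have wE: "w ` E b \<in> nsets Z r" if "b \<in> B" for b
    proof -
      have "inj_on w (E b)" using wI(1) E[OF that] inj_on_subset by blast
      then have "card (w ` E b) = r" using E[OF that] by (simp add: card_image)
      moreover have "w ` E b \<subseteq> Z" using wI(2) E[OF that] by blast
      ultimately show ?thesis using fZ finite_subset unfolding nsets_def by blast
    qed
    show "\<exists>x v. inj_on x I \<and> x ` I \<subseteq> V \<and> inj_on v B \<and> v ` B \<subseteq> V \<and> x ` I \<inter> v ` B = {} \<and>
         (\<forall>b\<in>B. x ` E b \<subseteq> nbr (v b))"
      using mono
    proof
      assume heavy: "\<forall>e\<in>nsets Z r. \<not> card (owners e) < m"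
      have "\<exists>v. inj_on v B \<and> (\<forall>b\<in>B. v b \<in> owners (w ` E b) - w ` I)"
      proof (rule distinct_representatives_avoiding[OF assms(2)])
        show "finite (w ` I)" using assms(1) by simp
        fix b assume "b \<in> B"
        then have "m \<le> card (owners (w ` E b))" using heavy wE by (metis not_less)
        moreover have "card (w ` I) \<le> k" unfolding k_def by (rule card_image_le[OF assms(1)])
        moreover have "finite (owners (w ` E b))" using owners_subset finV finite_subset by blast
        ultimately show "finite (owners (w ` E b)) \<and> card (w ` I) + card B \<le> card (owners (w ` E b))"
          unfolding m_def by linarith
      qed
      then obtain v where v: "inj_on v B" "\<And>b. b \<in> B \<Longrightarrow> v b \<in> owners (w ` E b)"
        "\<And>b. b \<in> B \<Longrightarrow> v b \<notin> w ` I" by blast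
      have "w ` E b \<subseteq> nbr (v b)" if "b \<in> B" for b
        using v(2)[OF that] piece unfolding owners_def by blast
      moreover have "v ` B \<subseteq> V" using v(2) owners_subset by blast
      moreover have "w ` I \<inter> v ` B = {}" using v(3) by (simp add: disjoint_iff) (metis image_iff)
      ultimately show ?thesis using wI ZV v(1) by (intro exI[of _ w] exI[of _ v]) auto
    next
      assume light: "\<forall>e\<in>nsets Z r. card (owners e) < m"
      define L where "L = light r m"
      have wL: "w ` E b \<in> L - M" if "b \<in> B" for b
      proof
        have e: "w ` E b \<in> nsets Z r" by (rule wE[OF that])
        have eW: "w ` E b \<in> nsets W r" using e Z(1) nsets_mono by blast
        have eQ: "w ` E b \<subseteq> Q" using eW W(1) unfolding nsets_def by blast
        \<comment> \<open>The piece \<open>Q\<close> supplies an owner, which together with the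
          bound on the number of owners makes the image light.\<close>
        then have "v0 \<in> owners (w ` E b)" using Q(1) unfolding owners_def by blast
        moreover have "w ` E b \<in> nsets V r" using e ZV nsets_mono by blast
        ultimately show "w ` E b \<in> L" using light e unfolding L_def light_def by blast
        show "w ` E b \<notin> M" using W(3) eW eQ unfolding M'_def by blast
      qed
      define X where "X = {x \<in> PiE I (\<lambda>_. V). \<forall>b\<in>B. x ` E b \<in> L}"
      have homs: "\<kappa> * n ^ card I \<le> real (card X)"
        unfolding X_def L_def
        by (rule M(3)[rule_format, of w]) (use wI ZV wL in \<open>simp add: L_def\<close>)
      have "\<exists>p. p \<in> \<P> \<and> e \<subseteq> snd p" if "e \<in> L" for e
        using that unfolding L_def light_def owners_def by auto
      then obtain pc where pc: "\<And>e. e \<in> L \<Longrightarrow> pc e \<in> \<P> \<and> e \<subseteq> snd (pc e)" by metis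
      define ok where "ok x \<longleftrightarrow> inj_on x I \<and> inj_on (\<lambda>b. fst (pc (x ` E b))) B \<and>
        (\<forall>b\<in>B. fst (pc (x ` E b)) \<notin> x ` I)" for x :: "'i \<Rightarrow> 'v"
      have degenerate: "card {x \<in> X. \<not> ok x} \<le> T * (card V ^ (card I - 1) * s)"
        unfolding T_def
        by (rule card_degenerate_homs[OF assms(1,2) spos E \<open>r \<ge> 2\<close> lin pc X_def, where Y="{x \<in> X. \<not> ok x}"])
          (simp_all add: ok_def)
      have "\<exists>x\<in>X. ok x"
      proof (rule ccontr)
        assume "\<not> (\<exists>x\<in>X. ok x)"
        then have "{x \<in> X. \<not> ok x} = X" by blast
        then have "real (card X) \<le> real (T * (card V ^ (card I - 1) * s))"
          using degenerate by (simp only: of_nat_le_iff)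
        then have le: "\<kappa> * n ^ card I \<le> real T * (n ^ (card I - 1) * real s)"
          using homs unfolding n_def by simp
        show False
        proof (cases "T = 0")
          case True
          then have "\<kappa> * n ^ card I \<le> 0" using le by simp
          moreover have "\<kappa> * n ^ card I > 0" using \<kappa> npos by simp
          ultimately show False by simp
        next
          case False
          \<comment> \<open>The exponent \<open>card I - 1\<close> is a truncated subtraction. An
            empty \<open>I\<close> forces \<open>B = {}\<close>, since every \<open>E b\<close> is
            nonempty, and then \<open>T = 0\<close>.\<close>
          have "card I \<noteq> 0"
          proof
            assume "card I = 0"
            then have "I = {}" using assms(1) by simp
            then have "B = {}" using E \<open>r \<ge> 2\<close> by fastforce
            then show False using \<open>T \<noteq> 0\<close> \<open>card I = 0\<close> unfolding T_def by simp
          qed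
          then have "n ^ card I = n ^ (card I - 1) * n" by (cases "card I") auto
          then have "n ^ (card I - 1) * (\<kappa> * n) \<le> n ^ (card I - 1) * (real T * real s)"
            using le by (simp add: mult_ac)
          then have "\<kappa> * n \<le> real T * real s" using npos by simp
          also have "\<dots> \<le> real T * (\<delta> * n)" using s(2) unfolding n_def by (intro mult_left_mono) auto
          also have "\<dots> < (2 * (real T + 1)) * (\<delta> * n)" using \<delta> npos by (intro mult_strict_right_mono) auto
          also have "\<dots> = \<kappa> * n" unfolding \<delta>_def by (simp add: field_simps)
          finally show False by simp
        qed
      qed
      then obtain x where x: "x \<in> X" "ok x" by blast
      define v where "v b = fst (pc (x ` E b))" for b
      have p: "(v b, snd (pc (x ` E b))) \<in> \<P>" "x ` E b \<subseteq> snd (pc (x ` E b))" if "b \<in> B" for b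
        using pc[of "x ` E b"] x(1) that unfolding X_def v_def by auto
      have "x ` E b \<subseteq> nbr (v b)" if "b \<in> B" for b using p[OF that] piece[OF p(1)[OF that]] by blast
      moreover have "v ` B \<subseteq> V"
      proof
        fix u assume "u \<in> v ` B"
        then obtain b where "b \<in> B" "u = v b" by blast
        then show "u \<in> V" using piece[OF p(1)] by blast
      qed
      moreover have "inj_on v B" "inj_on x I" and notin: "\<And>b. b \<in> B \<Longrightarrow> v b \<notin> x ` I"
        using x(2) unfolding ok_def v_def by auto
      moreover have "x ` I \<inter> v ` B = {}"
        using notin by (simp add: disjoint_iff) (metis image_iff)
      moreover have "x ` I \<subseteq> V" using x(1) unfolding X_def by auto
      ultimately show ?thesis by blast
    qed
  qed
qed

section \<open>Graphs\<close>

lemma disjoint_subsets_of_size: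
  assumes "finite X" "s > 0"
  shows "\<exists>D. card D = card X div s \<and> (\<forall>Q\<in>D. Q \<subseteq> X \<and> card Q = s) \<and>
    (\<forall>Q\<in>D. \<forall>Q'\<in>D. Q \<inter> Q' \<noteq> {} \<longrightarrow> Q = Q')"
  using assms(1)
proof (induction "card X" arbitrary: X rule: less_induct)
  case less
  show ?case
  proof (cases "card X < s")
    case True
    then show ?thesis by (intro exI[of _ "{}"]) simp
  next
    case False
    then obtain Q where Q: "Q \<subseteq> X" "card Q = s" by (meson not_less obtain_subset_with_card_n)
    have fQ: "finite Q" using Q less.prems finite_subset by blast
    have c: "card (X - Q) = card X - s" using Q fQ by (simp add: card_Diff_subset)
    have "card (X - Q) < card X" using c False assms(2) by linarith
    then obtain D where D: "card D = card (X - Q) div s" "\<forall>Q'\<in>D. Q' \<subseteq> X - Q \<and> card Q' = s" "\<forall>Q\<in>D. \<forall>Q'\<in>D. Q \<inter> Q' \<noteq> {} \<longrightarrow> Q = Q'"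
      using less.hyps[of "X - Q"] less.prems by auto
    have "D \<subseteq> Pow X" using D(2) by blast
    then have fD: "finite D" using less.prems finite_subset by blast
    have "Q \<noteq> {}" using Q(2) assms(2) by auto
    then have "Q \<notin> D" using D(2) by blast
    then have "card (insert Q D) = card X div s"
      using fD D(1) c False assms(2) by (simp add: le_div_geq)
    moreover have "\<forall>Q'\<in>insert Q D. Q' \<subseteq> X \<and> card Q' = s" using D(2) Q by blast
    moreover have "\<forall>P\<in>insert Q D. \<forall>P'\<in>insert Q D. P \<inter> P' \<noteq> {} \<longrightarrow> P = P'"
      using D(2,3) by blast
    ultimately show ?thesis by blast
  qed
qed

definition neighbours :: "'a ugraph \<Rightarrow> 'a \<Rightarrow> 'a set" where
  "neighbours G v = {u. {u, v} \<in> edges G}"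

lemma neighbours_subset:
  assumes "simple_graph G"
  shows "neighbours G v \<subseteq> verts G" "v \<notin> neighbours G v"
  using assms unfolding neighbours_def simple_graph_def by fastforce+

lemma finite_edges:
  assumes "simple_graph G"
  shows "finite (edges G)"
proof (rule finite_subset)
  show "edges G \<subseteq> Pow (verts G)" using assms unfolding simple_graph_def by blast
  show "finite (Pow (verts G))" using assms unfolding simple_graph_def by blast
qed

lemma degree_eq_card_neighbours:
  assumes "simple_graph G"
  shows "degree G v = card (neighbours G v)"
proof -
  have "bij_betw (\<lambda>u. {u, v}) (neighbours G v) {e \<in> edges G. v \<in> e}"
    unfolding bij_betw_def
  proof
    show "inj_on (\<lambda>u. {u, v}) (neighbours G v)" by (auto simp: inj_on_def doubleton_eq_iff)
    show "(\<lambda>u. {u, v}) ` neighbours G v = {e \<in> edges G. v \<in> e}"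
    proof
      show "{e \<in> edges G. v \<in> e} \<subseteq> (\<lambda>u. {u, v}) ` neighbours G v"
      proof
        fix e assume e: "e \<in> {e \<in> edges G. v \<in> e}"
        then have "card e = 2" using assms unfolding simple_graph_def by blast
        then obtain u where "e = {u, v}" using e by (auto simp: card_2_iff)
        then show "e \<in> (\<lambda>u. {u, v}) ` neighbours G v" using e unfolding neighbours_def by blast
      qed
    qed (auto simp: neighbours_def)
  qed
  then show ?thesis unfolding degree_def by (metis bij_betw_same_card)
qed

lemma sum_degree:
  assumes "simple_graph G"
  shows "(\<Sum>v\<in>verts G. degree G v) = 2 * card (edges G)"
proof -
  have fV: "finite (verts G)" and e2: "\<And>e. e \<in> edges G \<Longrightarrow> e \<subseteq> verts G \<and> card e = 2"
    using assms unfolding simple_graph_def by auto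
  have "(\<Sum>v\<in>verts G. degree G v) = (\<Sum>e\<in>edges G. card {v \<in> verts G. v \<in> e})"
    unfolding degree_def
    using sum.swap_restrict[OF fV finite_edges[OF assms], of "\<lambda>_ _. 1 :: nat" "\<lambda>v e. v \<in> e"] by simp
  also have "\<dots> = (\<Sum>e\<in>edges G. 2)"
  proof (rule sum.cong[OF refl])
    fix e assume "e \<in> edges G"
    then have "{v \<in> verts G. v \<in> e} = e" "card e = 2" using e2 by auto
    then show "card {v \<in> verts G. v \<in> e} = 2" by simp
  qed
  finally show ?thesis by simp
qed

text \<open>Cutting wastes fewer than \<open>s\<close> neighbours at each vertex, so at most
  \<open>s * card (verts G)\<close> in all. This is at most half of the degree sum
  \<open>2 * card (edges G)\<close>, and the other half still gives one piece per vertex on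
  average.\<close>

lemma graph_pieces:
  assumes "simple_graph G" "s > 0" "s * card (verts G) \<le> card (edges G)"
  shows "\<exists>\<P>. pieces (verts G) (neighbours G) \<P> s"
proof -
  have fV: "finite (verts G)" using assms(1) unfolding simple_graph_def by simp
  have fN: "finite (neighbours G v)" for v
    using neighbours_subset[OF assms(1)] fV finite_subset by blast
  have "\<forall>v. \<exists>D. card D = card (neighbours G v) div s \<and> (\<forall>Q\<in>D. Q \<subseteq> neighbours G v \<and> card Q = s) \<and>
    (\<forall>Q\<in>D. \<forall>Q'\<in>D. Q \<inter> Q' \<noteq> {} \<longrightarrow> Q = Q')"
    using disjoint_subsets_of_size[OF fN assms(2)] by blast
  then obtain D where D: "\<And>v. card (D v) = card (neighbours G v) div s"
    "\<And>v Q. Q \<in> D v \<Longrightarrow> Q \<subseteq> neighbours G v \<and> card Q = s"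
    "\<And>v Q Q'. Q \<in> D v \<Longrightarrow> Q' \<in> D v \<Longrightarrow> Q \<inter> Q' \<noteq> {} \<Longrightarrow> Q = Q'" by metis
  have fD: "finite (D v)" for v
  proof (rule finite_subset)
    show "D v \<subseteq> Pow (neighbours G v)" using D(2) by blast
    show "finite (Pow (neighbours G v))" using fN by simp
  qed
  have "2 * (s * card (verts G)) \<le> (\<Sum>v\<in>verts G. degree G v)"
    using assms(3) unfolding sum_degree[OF assms(1)] by simp
  also have "\<dots> \<le> (\<Sum>v\<in>verts G. s * card (D v) + s)"
  proof (rule sum_mono)
    fix v
    have "degree G v = s * (degree G v div s) + degree G v mod s" by simp
    also have "\<dots> \<le> s * (degree G v div s) + s"
      using mod_less_divisor[OF assms(2), of "degree G v"] by linarith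
    finally show "degree G v \<le> s * card (D v) + s"
      unfolding D(1) degree_eq_card_neighbours[OF assms(1)] .
  qed
  also have "\<dots> = s * (\<Sum>v\<in>verts G. card (D v)) + s * card (verts G)"
    by (simp add: sum.distrib sum_distrib_left mult.commute)
  finally have "s * card (verts G) \<le> s * (\<Sum>v\<in>verts G. card (D v))" by simp
  then have "card (verts G) \<le> (\<Sum>v\<in>verts G. card (D v))" using assms(2) by simp
  also have "\<dots> = card (Sigma (verts G) D)" using fV fD by (simp add: card_SigmaI)
  finally have many: "card (verts G) \<le> card (Sigma (verts G) D)" .
  have "pieces (verts G) (neighbours G) (Sigma (verts G) D) s"
  proof
    show "v \<in> verts G \<and> Q \<subseteq> neighbours G v \<and> Q \<subseteq> verts G \<and> card Q = s"
      if "(v, Q) \<in> Sigma (verts G) D" for v Q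
      using that D(2) neighbours_subset(1)[OF assms(1), of v] by blast
    show "Q = Q'" if "(v, Q) \<in> Sigma (verts G) D" "(v, Q') \<in> Sigma (verts G) D" "Q \<inter> Q' \<noteq> {}" for v Q Q'
      using that D(3) by blast
  qed (use fV many neighbours_subset(2)[OF assms(1)] in auto)
  then show ?thesis by blast
qed

text \<open>Two common neighbours \<open>a\<close> and \<open>a'\<close> would close the 4-cycle
  \<open>a\<close>, \<open>b\<close>, \<open>a'\<close>, \<open>b'\<close>.\<close>

lemma C4_free_common_neighbours:
  assumes "simple_graph H" "\<not> contains_graph H (cycle_graph 4)" "b \<noteq> b'"
  shows "card (neighbours H b \<inter> neighbours H b') \<le> 1"
proof (rule ccontr)
  assume "\<not> ?thesis"
  moreover have "finite (neighbours H b \<inter> neighbours H b')"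
    using assms(1) neighbours_subset(1)[OF assms(1)] unfolding simple_graph_def
    by (meson finite_Int finite_subset)
  ultimately obtain a a' where a: "a \<in> neighbours H b \<inter> neighbours H b'"
    "a' \<in> neighbours H b \<inter> neighbours H b'" "a \<noteq> a'"
    by (metis One_nat_def card_le_Suc0_iff_eq)
  have ne: "a \<noteq> b" "a \<noteq> b'" "a' \<noteq> b" "a' \<noteq> b'" using a neighbours_subset(2)[OF assms(1)] by auto
  have edge: "{a, b} \<in> edges H" "{a, b'} \<in> edges H" "{a', b} \<in> edges H" "{a', b'} \<in> edges H"
    using a unfolding neighbours_def by auto
  have verts: "a \<in> verts H" "a' \<in> verts H" "b \<in> verts H" "b' \<in> verts H"
    using edge assms(1) unfolding simple_graph_def by auto
  have less4: "i < 4 \<longleftrightarrow> i = 0 \<or> i = 1 \<or> i = 2 \<or> i = 3" for i :: nat by auto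
  have C4: "edges (cycle_graph 4) = {{0, 1}, {1, 2}, {2, 3}, {3, 0}}"
  proof -
    have "edges (cycle_graph 4) = (\<lambda>i. {i, Suc i mod 4}) ` {i. i < 4}"
      unfolding cycle_graph_def by auto
    also have "{i :: nat. i < 4} = {0, 1, 2, 3}" using less4 by blast
    finally have eq: "edges (cycle_graph 4) = (\<lambda>i. {i, Suc i mod 4}) ` {0, 1, 2, 3}" .
    have "Suc 0 mod 4 = 1" "Suc 1 mod 4 = 2" "Suc 2 mod 4 = 3" "Suc 3 mod 4 = (0 :: nat)" by simp_all
    then show ?thesis unfolding eq image_insert image_empty by (simp only:)
  qed
  have vC4: "verts (cycle_graph 4) = {0, 1, 2, 3}" 
  proof -
    have "{i :: nat. i < 4} = {0, 1, 2, 3}" using less4 by blast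
    then show ?thesis unfolding cycle_graph_def lessThan_def by (simp only: ugraph.simps)
  qed
  have "simple_graph (cycle_graph 4)" unfolding simple_graph_def C4 vC4 by simp
  moreover define f where "f = (\<lambda>i :: nat. if i = 0 then a else if i = 1 then b else if i = 2 then a' else b')"
  have "inj_on f {0, 1, 2, 3}" using ne a(3) assms(3) unfolding f_def inj_on_def by auto
  moreover have "f ` {0, 1, 2, 3} \<subseteq> verts H" unfolding f_def using verts by auto
  moreover have "\<forall>e\<in>edges (cycle_graph 4). f ` e \<in> edges H"
    unfolding C4 f_def using edge by (auto simp: insert_commute)
  ultimately have "contains_graph H (cycle_graph 4)"
    using contains_graph_iff_embedding[OF assms(1)] vC4 by metis
  then show False using assms(2) by simp
qed

text \<open>The star of each \<open>b \<in> B\<close> is padded with dummy vertices \<open>Inr (b, j)\<close>, so that all of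
  the hyperedges have size \<open>r\<close>.\<close>

lemma low_degree_C4_free_embeds:
  fixes H :: "'a ugraph" and K :: real
  assumes "r \<ge> 2" "simple_graph H" "bipartition H A B" "\<forall>v\<in>B. degree H v \<le> r"
    and "\<not> contains_graph H (cycle_graph 4)" "K > 0"
  shows "\<exists>R :: nat. \<exists>\<delta> > 0. \<forall>(G :: 'v ugraph) s.
    simple_graph G \<and> s * card (verts G) \<le> card (edges G) \<and> 0 < s \<and> R \<le> s \<and>
    real s \<le> \<delta> * real (card (verts G)) \<and> real (card (verts G)) ^ (r - 1) \<le> K * real s ^ r \<longrightarrow>
      contains_graph G H"
proof -
  have AB: "A \<union> B = verts H" "A \<inter> B = {}"
    and edgeH: "\<And>e. e \<in> edges H \<Longrightarrow> \<exists>a\<in>A. \<exists>b\<in>B. e = {a, b}"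
    using assms(3) unfolding bipartition_def by auto
  have fin: "finite A" "finite B" using assms(2) AB(1) unfolding simple_graph_def by (metis finite_Un)+
  define I where "I = Inl ` A \<union> Inr ` (B \<times> {..<r})"
  \<comment> \<open>The tag \<open>b\<close> keeps the dummies of different hyperedges apart, so
    padding preserves linearity.\<close>
  define E where "E b = Inl ` neighbours H b \<union> Inr ` ({b} \<times> {..<r - card (neighbours H b)})" for b
  have nbA: "neighbours H b \<subseteq> A" if "b \<in> B" for b
  proof
    fix u assume "u \<in> neighbours H b"
    then obtain a b' where "a \<in> A" "b' \<in> B" "{u, b} = {a, b'}"
      using edgeH unfolding neighbours_def by blast
    then show "u \<in> A" using that AB(2) by (auto simp: doubleton_eq_iff)
  qed
  have fI: "finite I" unfolding I_def using fin by simp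
  have E: "E b \<subseteq> I \<and> card (E b) = r" if b: "b \<in> B" for b
  proof
    show "E b \<subseteq> I" unfolding E_def I_def using nbA[OF b] b by auto
    have fn: "finite (neighbours H b)" using nbA[OF b] fin(1) finite_subset by blast
    have "card (E b) = card (Inl ` neighbours H b :: ('a + 'a \<times> nat) set)
        + card (Inr ` ({b} \<times> {..<r - card (neighbours H b)}) :: ('a + 'a \<times> nat) set)"
      unfolding E_def using fn by (intro card_Un_disjoint) auto
    also have "\<dots> = card (neighbours H b) + (r - card (neighbours H b))"
      by (simp add: card_image card_cartesian_product)
    also have "\<dots> = r" using assms(4) b unfolding degree_eq_card_neighbours[OF assms(2)] by simp
    finally show "card (E b) = r" .
  qed
  have lin: "card (E b \<inter> E b') \<le> 1" if "b \<in> B" "b' \<in> B" "b \<noteq> b'" for b b'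
  proof -
    have "E b \<inter> E b' = Inl ` (neighbours H b \<inter> neighbours H b')"
      unfolding E_def using that(3) by auto
    then have "card (E b \<inter> E b') = card (neighbours H b \<inter> neighbours H b')"
      by (simp add: card_image)
    then show ?thesis using C4_free_common_neighbours[OF assms(2,5) that(3)] by simp
  qed
  have "\<exists>R :: nat. \<exists>\<delta> > 0. \<forall>(V :: 'v set) nbr \<P> s.
    pieces V nbr \<P> s \<and> R \<le> s \<and> real s \<le> \<delta> * real (card V) \<and> real (card V) ^ (r - 1) \<le> K * real s ^ r \<longrightarrow>
      (\<exists>x v. inj_on x I \<and> x ` I \<subseteq> V \<and> inj_on v B \<and> v ` B \<subseteq> V \<and> x ` I \<inter> v ` B = {} \<and>
         (\<forall>b\<in>B. x ` E b \<subseteq> nbr (v b)))"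
    by (rule pieces_embed_linear_hypergraph[OF fI fin(2) _ assms(1) _ assms(6)]) (use E lin in auto)
  then obtain R \<delta> where \<delta>: "\<delta> > 0" and R: "\<forall>(V :: 'v set) nbr \<P> s.
    pieces V nbr \<P> s \<and> R \<le> s \<and> real s \<le> \<delta> * real (card V) \<and> real (card V) ^ (r - 1) \<le> K * real s ^ r \<longrightarrow>
      (\<exists>x v. inj_on x I \<and> x ` I \<subseteq> V \<and> inj_on v B \<and> v ` B \<subseteq> V \<and> x ` I \<inter> v ` B = {} \<and>
         (\<forall>b\<in>B. x ` E b \<subseteq> nbr (v b)))"
    by (elim exE conjE)
  show ?thesis
  proof (intro exI[of _ R] exI[of _ \<delta>] conjI allI impI, rule \<delta>, elim conjE)
    fix G :: "'v ugraph" and s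
    assume G: "simple_graph G" "s * card (verts G) \<le> card (edges G)" "0 < s" "R \<le> s"
       "real s \<le> \<delta> * real (card (verts G))" "real (card (verts G)) ^ (r - 1) \<le> K * real s ^ r"
    obtain \<P> where "pieces (verts G) (neighbours G) \<P> s" using graph_pieces[OF G(1,3,2)] by blast
    with R G(4-6) have "\<exists>x v. inj_on x I \<and> x ` I \<subseteq> verts G \<and> inj_on v B \<and> v ` B \<subseteq> verts G \<and>
        x ` I \<inter> v ` B = {} \<and> (\<forall>b\<in>B. x ` E b \<subseteq> neighbours G (v b))"
      by (intro R[rule_format] conjI)
    then obtain x v where x: "inj_on x I" "x ` I \<subseteq> verts G"
      and v: "inj_on v B" "v ` B \<subseteq> verts G" and xv: "x ` I \<inter> v ` B = {}"
      and nbr: "\<forall>b\<in>B. x ` E b \<subseteq> neighbours G (v b)" by (elim exE conjE)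
    \<comment> \<open>The dummies are dropped: \<open>A\<close> uses only the images of the
      \<open>Inl\<close> vertices, and \<open>B\<close> goes to the owners.\<close>
    define f where "f u = (if u \<in> A then x (Inl u) else v u)" for u
    have fA: "f u = x (Inl u)" "x (Inl u) \<in> x ` I" if "u \<in> A" for u
      using that unfolding f_def I_def by auto
    have fB: "f u = v u" "v u \<in> v ` B" if "u \<in> B" for u using that AB(2) unfolding f_def by auto
    have "inj_on f (A \<union> B)"
    proof (rule inj_onI)
      fix u u' assume u: "u \<in> A \<union> B" "u' \<in> A \<union> B" "f u = f u'"
      consider "u \<in> A" "u' \<in> A" | "u \<in> B" "u' \<in> B" | "u \<in> A" "u' \<in> B" | "u \<in> B" "u' \<in> A"
        using u by blast
      then show "u = u'"
      proof cases
        case 1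
        then have "(Inl u :: 'a + 'a \<times> nat) = Inl u'"
          using u(3) fA(1) by (intro inj_onD[OF x(1)]) (auto simp: I_def)
        then show ?thesis by simp
      next
        case 2
        then show ?thesis using u(3) fB(1) inj_onD[OF v(1)] by metis
      next
        case 3
        then show ?thesis using u(3) fA fB xv by (metis disjoint_iff)
      next
        case 4
        then show ?thesis using u(3) fA fB xv by (metis disjoint_iff)
      qed
    qed
    moreover have "f ` (A \<union> B) \<subseteq> verts G"
    proof
      fix y assume "y \<in> f ` (A \<union> B)"
      then show "y \<in> verts G" using fA fB x(2) v(2) by auto
    qed
    moreover have "\<forall>e\<in>edges H. f ` e \<in> edges G"
    proof
      fix e assume e: "e \<in> edges H"
      then obtain a b where ab: "a \<in> A" "b \<in> B" "e = {a, b}" using edgeH by blast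
      then have "Inl a \<in> E b" using e unfolding E_def neighbours_def by blast
      then have "x (Inl a) \<in> neighbours G (v b)" using nbr[rule_format, OF ab(2)] by blast
      then show "f ` e \<in> edges G" unfolding ab(3) neighbours_def using fA(1)[OF ab(1)] fB(1)[OF ab(2)] by simp
    qed
    ultimately show "contains_graph G H"
      using contains_graph_iff_embedding[OF G(1) assms(2)] AB(1) by metis
  qed
qed

section \<open>Choosing the piece size and passing to the asymptotic bound\<close>

lemma eventually_powr_window:
  fixes a c \<delta> M :: real
  assumes "0 < a" "a < 1" "c > 0" "\<delta> > 0"
  shows "\<forall>\<^sub>F n in sequentially. M \<le> c * real n powr a \<and> real n powr a \<le> \<delta> * real n"
proof -
  have lim: "filterlim real at_top sequentially" by (rule filterlim_real_sequentially)
  have 1: "((\<lambda>n. real n powr (- a)) \<longlongrightarrow> 0) sequentially"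
    by (rule tendsto_neg_powr[OF _ lim]) (use assms in simp)
  have 2: "((\<lambda>n. real n powr (a - 1)) \<longlongrightarrow> 0) sequentially"
    by (rule tendsto_neg_powr[OF _ lim]) (use assms in simp)
  \<comment> \<open>\<open>max 1 M\<close> keeps the denominator positive even when \<open>M\<close>
    is not.\<close>
  have "\<forall>\<^sub>F n in sequentially. real n powr (- a) < c / max 1 M"
    using order_tendstoD(2)[OF 1, of "c / max 1 M"] assms(3) by simp
  moreover have "\<forall>\<^sub>F n in sequentially. real n powr (a - 1) < \<delta>"
    using order_tendstoD(2)[OF 2] assms(4) by simp
  moreover have "\<forall>\<^sub>F n in sequentially. n > 0" by (rule eventually_gt_at_top)
  ultimately show ?thesis
  proof eventually_elim
    case (elim n)
    have pos: "real n powr a > 0" using elim(3) by simp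
    have "inverse (real n powr a) < c / max 1 M" using elim(1) by (simp add: powr_minus)
    then have "max 1 M < c * real n powr a" using pos by (simp add: field_simps)
    moreover have "real n powr a = real n powr (a - 1) * real n"
      using elim(3) by (simp add: powr_diff)
    then have "real n powr a \<le> \<delta> * real n" using elim(2) by (simp add: mult_right_mono)
    ultimately show ?case by simp
  qed
qed

text \<open>A nonempty finite set of naturals attains its supremum; \<open>0 \<le> y\<close> covers
  the empty set, whose supremum is 0.\<close>

lemma extremal_number_le:
  fixes H :: "'a ugraph"
  assumes "\<And>G :: nat ugraph. simple_graph G \<Longrightarrow> card (verts G) = n \<Longrightarrow> \<not> contains_graph G H \<Longrightarrow>
    real (card (edges G)) \<le> y" "0 \<le> y"
  shows "real (extremal_number n H) \<le> y"
proof -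
  define S where "S = {card (edges G) | G :: nat ugraph.
      simple_graph G \<and> card (verts G) = n \<and> \<not> contains_graph G H}"
  have ext: "extremal_number n H = Sup S" unfolding extremal_number_def S_def ..
  have finS: "finite S" unfolding S_def by (rule finite_edge_counts)
  show ?thesis
  proof (cases "S = {}")
    case True
    then show ?thesis using assms(2) unfolding ext by (simp add: Sup_nat_def)
  next
    case False
    then have "Sup S \<in> S" using finS by (simp add: Sup_nat_def)
    moreover have "\<forall>k\<in>S. real k \<le> y" unfolding S_def using assms(1) by auto
    ultimately show ?thesis unfolding ext by blast
  qed
qed

theorem theorem1p4:
  fixes r :: nat and H :: "'a ugraph" and A B :: "'a set"
  assumes "r \<ge> 2"
    and "simple_graph H"
    and "bipartition H A B"
    and "\<forall>v\<in>B. degree H v \<le> r"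
    and "\<not> contains_graph H (cycle_graph 4)"
  shows "(\<lambda>n. real (extremal_number n H)) \<in> o(\<lambda>n. real n powr (2 - 1 / real r))"
proof (rule landau_o.smallI)
  fix c :: real assume c: "c > 0"
  \<comment> \<open>The piece size will be about \<open>c0 * real n powr a\<close>; here
    \<open>a * real r = real (r - 1)\<close> and \<open>1 + a = 2 - 1 / real r\<close>.\<close>
  define a where "a = 1 - 1 / real r"
  have a: "0 < a" "a < 1" unfolding a_def using assms(1) by auto
  \<comment> \<open>\<open>c0 \<le> c\<close> ensures that the edges suffice for pieces of size
    \<open>s\<close>, and \<open>c0 \<le> 1\<close> that \<open>s\<close> is at most
    \<open>n powr a\<close>, hence at most \<delta> n.\<close>
  define c0 where "c0 = min 1 c"
  have c0: "0 < c0" "c0 \<le> 1" "c0 \<le> c" unfolding c0_def using c by auto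
  \<comment> \<open>This comes from \<open>n ^ (r - 1) = (n powr a) ^ r\<close> and
    \<open>s \<ge> c0 * n powr a / 2\<close>.\<close>
  define K where "K = (2 / c0) ^ r"
  have "K > 0" unfolding K_def using c0 by simp
  then have "\<exists>R :: nat. \<exists>\<delta> > 0. \<forall>(G :: nat ugraph) s.
    simple_graph G \<and> s * card (verts G) \<le> card (edges G) \<and> 0 < s \<and> R \<le> s \<and>
    real s \<le> \<delta> * real (card (verts G)) \<and> real (card (verts G)) ^ (r - 1) \<le> K * real s ^ r \<longrightarrow>
      contains_graph G H"
    by (rule low_degree_C4_free_embeds[OF assms])
  then obtain R :: nat and \<delta> :: real where \<delta>: "\<delta> > 0" and
    embeds: "\<forall>(G :: nat ugraph) s.
    simple_graph G \<and> s * card (verts G) \<le> card (edges G) \<and> 0 < s \<and> R \<le> s \<and>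
    real s \<le> \<delta> * real (card (verts G)) \<and> real (card (verts G)) ^ (r - 1) \<le> K * real s ^ r \<longrightarrow>
      contains_graph G H"
    by (elim exE conjE)
  \<comment> \<open>The margin 2 absorbs the rounding of \<open>y\<close> down to \<open>s\<close>:
    it gives \<open>R \<le> s\<close>, \<open>0 < s\<close> and
    \<open>s \<ge> y / 2\<close>.\<close>
  have "\<forall>\<^sub>F n in sequentially. real (R + 2) \<le> c0 * real n powr a \<and> real n powr a \<le> \<delta> * real n"
    by (rule eventually_powr_window[OF a c0(1) \<delta>])
  then show "\<forall>\<^sub>F n in sequentially. norm (real (extremal_number n H)) \<le> c * norm (real n powr (2 - 1 / real r))"
    using eventually_gt_at_top[of 0]
  proof eventually_elim
    case (elim n)
    define y where "y = c0 * real n powr a"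
    define s where "s = nat \<lfloor>y\<rfloor>"
    have y2: "y \<ge> real R + 2" using elim(1) unfolding y_def by simp
    have s: "real s \<le> y" "real s > y - 1" unfolding s_def using y2 by linarith+
    have "R \<le> s" "0 < s" using s(2) y2 by linarith+
    have half: "real s \<ge> y / 2" using s(2) y2 by linarith
    have pw: "real n powr (2 - 1 / real r) = real n powr a * real n"
      unfolding a_def using elim(2) by (simp add: powr_diff power2_eq_square[symmetric] powr_numeral)
    have "real (card (edges G)) \<le> c * real n powr (2 - 1 / real r)"
      if G: "simple_graph G" "card (verts G) = n" "\<not> contains_graph G H" for G :: "nat ugraph"
    proof (rule ccontr)
      assume "\<not> ?thesis"
      then have "c * (real n powr a * real n) < real (card (edges G))" unfolding pw by simp
      moreover have "real s * real n \<le> c * (real n powr a * real n)"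
      proof -
        have "real s \<le> c * real n powr a" using s(1) c0(3) unfolding y_def
          by (meson mult_right_mono order_trans powr_ge_zero)
        then show ?thesis by (simp add: mult.assoc[symmetric] mult_right_mono)
      qed
      ultimately have "real (s * card (verts G)) \<le> real (card (edges G))" using G(2) by simp
      then have 1: "s * card (verts G) \<le> card (edges G)" by (simp only: of_nat_le_iff)
      have "y \<le> real n powr a" unfolding y_def using c0(1,2) by (simp add: mult_left_le_one_le)
      then have 2: "real s \<le> \<delta> * real (card (verts G))" using s(1) elim(1) unfolding G(2) by linarith
      have "real n ^ (r - 1) = (real n powr a) ^ r"
      proof -
        have "a * real r = real (r - 1)" unfolding a_def using assms(1) by (simp add: field_simps of_nat_diff)
        then show ?thesis using elim(2) by (metis of_nat_0_less_iff powr_powr powr_realpow powr_gt_zero less_irrefl)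
      qed
      also have "\<dots> = (2 / c0 * (y / 2)) ^ r" unfolding y_def using c0(1) by simp
      also have "\<dots> \<le> (2 / c0 * real s) ^ r"
        using half c0(1) y2 by (intro power_mono mult_left_mono) auto
      also have "\<dots> = K * real s ^ r" unfolding K_def by (simp only: power_mult_distrib)
      finally have 3: "real (card (verts G)) ^ (r - 1) \<le> K * real s ^ r" unfolding G(2) .
      have "contains_graph G H" using embeds G(1) 1 2 3 \<open>0 < s\<close> \<open>R \<le> s\<close> by blast
      then show False using G(3) by simp
    qed
    then have "real (extremal_number n H) \<le> c * real n powr (2 - 1 / real r)"
      by (rule extremal_number_le) (use c in auto)
    then show ?case by simp
  qed
qed

end
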